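(* Let $m$ be a positive integer and let $R(3,m)=\mathbb{C}[\operatorname{Mat}_{3,3}^m]^{\operatorname{SL}_3\times\operatorname{SL}_3}$. The null cone of $R(3,m)$ is defined by a finite set of invariants of degree $\le 6$, namely: (i) a set of at most $9m-16$ invariants of degree $3$ that define the same subvariety of $\operatorname{Mat}_{3,3}^m$ as the vanishing of all invariants of degree $3$; together with (ii) the degree $6$ invariants $$g_{i,j,k}(X_1,\dots,X_m):=\det\begin{pmatrix} X_j & X_i\\ X_i & X_k\end{pmatrix},\qquad 1\le i<j<k\le m,$$ where the matrix displayed is a $6\times 6$ matrix written in $3\times 3$ blocks.
   Context: The ground field is $\mathbb{C}$. $\operatorname{Mat}_{n,n}$ is the space of $n\times n$ complex matrices. The group $\operatorname{SL}_n\times\operatorname{SL}_n$ acts on $\operatorname{Mat}_{n,n}^m$ by $(A,B)\circ(X_1,\dots,X_m)=(AX_1B^{-1},\dots,AX_mB^{-1})$, and $R(n,m)=\mathbb{C}[\operatorname{Mat}_{n,n}^m]^{\operatorname{SL}_n\times\operatorname{SL}_n}$ is the ring of invariant polynomials, graded by the usual degree of polynomials in the matrix entries. The null cone of $R(n,m)$ is the set of $v\in\operatorname{Mat}_{n,n}^m$ such that $f(v)=0$ for every homogeneous $f\in R(n,m)$ of positive degree. A set of invariants defines the null cone if its common zero set is the null cone.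
   Formalization: The bound 9m-16 on the number of degree 3 invariants is claimed only for m at least 3, since it is false for m=1 (negative) and m=2 (zero set has codimension 4, bound is 2); for m=1,2 the rest is proved with a finite set of degree 3 invariants. *)

theory Defs
  imports "HOL-Analysis.Analysis" "HOL-Library.Poly_Mapping"
begin

text \<open>
  An \<open>m\<close>-tuple of complex \<open>n \<times> n\<close> matrices is an element of type \<open>complex^'n^'n^'m\<close> with
  \<open>m = CARD('m)\<close> and \<open>n = CARD('n)\<close>. The polynomial ring on this space consists of the finitely
  supported maps from monomials (exponent vectors in the variables \<open>(l, a, b)\<close>, the \<open>(a, b)\<close> entry
  of the \<open>l\<close>-th matrix) to coefficients, with the convolution product of Poly_Mapping.
\<close>

type_synonym ('n, 'm) matpoly = "('m \<times> 'n \<times> 'n \<Rightarrow>\<^sub>0 nat) \<Rightarrow>\<^sub>0 complex"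

definition eval_mon :: "('m \<times> 'n \<times> 'n \<Rightarrow>\<^sub>0 nat) \<Rightarrow> complex^'n^'n^'m \<Rightarrow> complex" where
  "eval_mon t X = (\<Prod>(l, a, b)\<in>Poly_Mapping.keys t. (X $ l $ a $ b) ^ Poly_Mapping.lookup t (l, a, b))"

definition eval_poly :: "('n, 'm) matpoly \<Rightarrow> complex^'n^'n^'m \<Rightarrow> complex" where
  "eval_poly f X = (\<Sum>t\<in>Poly_Mapping.keys f. Poly_Mapping.lookup f t * eval_mon t X)"

definition mon_degree :: "('v \<Rightarrow>\<^sub>0 nat) \<Rightarrow> nat" where
  "mon_degree t = (\<Sum>v\<in>Poly_Mapping.keys t. Poly_Mapping.lookup t v)"

definition homogeneous :: "nat \<Rightarrow> ('n, 'm) matpoly \<Rightarrow> bool" where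
  "homogeneous d f \<longleftrightarrow> (\<forall>t\<in>Poly_Mapping.keys f. mon_degree t = d)"

definition SL :: "(complex^'n^'n) set" where
  "SL = {A. det A = 1}"

definition act :: "complex^'n^'n \<Rightarrow> complex^'n^'n \<Rightarrow> complex^'n^'n^'m \<Rightarrow> complex^'n^'n^'m" where
  "act A B X = (\<chi> l. A ** (X $ l) ** matrix_inv B)"

definition invariants :: "('n::finite, 'm::finite) matpoly set" where
  "invariants = {f. \<forall>A\<in>SL. \<forall>B\<in>SL. \<forall>X. eval_poly f (act A B X) = eval_poly f X}"

definition invariants_of_degree :: "nat \<Rightarrow> ('n::finite, 'm::finite) matpoly set" where
  "invariants_of_degree d = {f \<in> invariants. homogeneous d f}"

definition zero_set :: "('n, 'm) matpoly set \<Rightarrow> (complex^'n^'n^'m) set" where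
  "zero_set F = {X. \<forall>f\<in>F. eval_poly f X = 0}"

definition null_cone :: "(complex^'n::finite^'n^'m::finite) set" where
  "null_cone = zero_set (\<Union>d\<in>{0<..}. invariants_of_degree d)"

definition block_mat :: "'a^'n^'n \<Rightarrow> 'a^'n^'n \<Rightarrow> 'a^'n^'n \<Rightarrow> 'a^'n^'n \<Rightarrow> 'a^('n + 'n)^('n + 'n)" where
  "block_mat P Q R S = (\<chi> r c.
     (case (r, c) of
        (Inl a, Inl b) \<Rightarrow> P $ a $ b
      | (Inl a, Inr b) \<Rightarrow> Q $ a $ b
      | (Inr a, Inl b) \<Rightarrow> R $ a $ b
      | (Inr a, Inr b) \<Rightarrow> S $ a $ b))"

text \<open>The \<open>l\<close>-th coordinate matrix, whose entries are the variables themselves.\<close>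

definition generic_mat :: "'m \<Rightarrow> ('n, 'm) matpoly^'n^'n" where
  "generic_mat l = (\<chi> a b. Poly_Mapping.single (Poly_Mapping.single (l, a, b) 1) 1)"

definition g_poly :: "'m \<Rightarrow> 'm \<Rightarrow> 'm \<Rightarrow> ('n::finite, 'm) matpoly" where
  "g_poly i j k =
     det (block_mat (generic_mat j) (generic_mat i) (generic_mat i) (generic_mat k))"

text \<open>
  The lemmas below lead to \<open>eval_g_poly\<close>: as a function, \<open>g_poly i j k\<close> is
  \<open>X \<mapsto> det (block_mat X\<^sub>j X\<^sub>i X\<^sub>i X\<^sub>k)\<close>.
\<close>

lemma eval_poly_superset:
  assumes "finite K" "Poly_Mapping.keys f \<subseteq> K"
  shows "eval_poly f X = (\<Sum>t\<in>K. Poly_Mapping.lookup f t * eval_mon t X)"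
  unfolding eval_poly_def
  by (rule sum.mono_neutral_left) (use assms in \<open>auto simp: in_keys_iff\<close>)

lemma eval_mon_eq: "eval_mon t X = (\<Prod>(l, a, b)\<in>UNIV. (X $ l $ a $ b) ^ Poly_Mapping.lookup t (l, a, b))"
  for X :: "complex^'n::finite^'n^'m::finite"
  unfolding eval_mon_def
  by (rule prod.mono_neutral_left) (auto simp: in_keys_iff)

lemma eval_mon_add: "eval_mon (s + t) X = eval_mon s X * eval_mon t X"
  for X :: "complex^'n::finite^'n^'m::finite"
  by (simp add: eval_mon_eq lookup_add power_add prod.distrib case_prod_unfold)

lemma eval_poly_zero [simp]: "eval_poly 0 X = 0"
  by (simp add: eval_poly_def)

lemma eval_poly_add: "eval_poly (f + g) X = eval_poly f X + eval_poly g X"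
proof -
  let ?K = "Poly_Mapping.keys f \<union> Poly_Mapping.keys g"
  have "Poly_Mapping.keys (f + g) \<subseteq> ?K" by (rule keys_add)
  then show ?thesis
    by (simp add: eval_poly_superset[of ?K] lookup_add ring_distribs sum.distrib)
qed

lemma eval_poly_single: "eval_poly (Poly_Mapping.single t c) X = c * eval_mon t X"
  by (simp add: eval_poly_superset[of "{t}"])

lemma poly_mapping_single_add_induct [case_names zero add]:
  assumes "P 0" "\<And>k v p. P p \<Longrightarrow> P (Poly_Mapping.single k v + p)"
  shows "P (p :: 'a \<Rightarrow>\<^sub>0 'b::comm_monoid_add)"
proof (induction p rule: update_induct)
  case const
  show ?case by fact
next
  case (update f a b)
  have "Poly_Mapping.update a b f = Poly_Mapping.single a b + f"
    using update(1)
    by (intro poly_mapping_eqI) (auto simp: lookup_update lookup_add lookup_single in_keys_iff when_def)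
  then show ?case using assms(2) update.IH by simp
qed

lemma eval_poly_mult_single:
  "eval_poly (Poly_Mapping.single t c * f) X = c * eval_mon t X * eval_poly f X"
  for X :: "complex^'n::finite^'n^'m::finite"
proof (induction f rule: poly_mapping_single_add_induct)
  case zero
  show ?case by simp
next
  case (add k v p)
  then show ?case
    by (simp add: ring_distribs eval_poly_add mult_single eval_poly_single eval_mon_add)
qed

lemma eval_poly_mult: "eval_poly (f * g) X = eval_poly f X * eval_poly g X"
  for X :: "complex^'n::finite^'n^'m::finite"
proof (induction f rule: poly_mapping_single_add_induct)
  case zero
  show ?case by simp
next
  case (add k v p)
  then show ?case
    by (simp add: ring_distribs eval_poly_add eval_poly_mult_single eval_poly_single)
qed

lemma eval_poly_const: "eval_poly (Poly_Mapping.single 0 c) X = c"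
  by (simp add: eval_poly_single eval_mon_def)

lemma eval_poly_one [simp]: "eval_poly 1 X = 1"
  using eval_poly_const[of 1] by simp

lemma eval_poly_of_int: "eval_poly (of_int z) X = of_int z"
  using eval_poly_const[of "of_int z"] by simp

lemma eval_poly_sum: "eval_poly (\<Sum>i\<in>I. f i) X = (\<Sum>i\<in>I. eval_poly (f i) X)"
  by (induction I rule: infinite_finite_induct) (simp_all add: eval_poly_add)

lemma eval_poly_prod: "eval_poly (\<Prod>i\<in>I. f i) X = (\<Prod>i\<in>I. eval_poly (f i) X)"
  for X :: "complex^'n::finite^'n^'m::finite"
  by (induction I rule: infinite_finite_induct) (simp_all add: eval_poly_mult)

lemma eval_generic_mat: "eval_poly (generic_mat l $ a $ b) X = X $ l $ a $ b"
  by (simp add: generic_mat_def eval_poly_single eval_mon_def)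

lemma eval_g_poly:
  "eval_poly (g_poly i j k) X = det (block_mat (X $ j) (X $ i) (X $ i) (X $ k))"
  for X :: "complex^'n::finite^'n^'m::finite"
proof -
  have "eval_poly (block_mat (generic_mat j) (generic_mat i) (generic_mat i) (generic_mat k) $ r $ c) X
      = block_mat (X $ j) (X $ i) (X $ i) (X $ k) $ r $ c" for r c
    by (simp add: block_mat_def eval_generic_mat split: sum.splits)
  then show ?thesis
    by (simp add: g_poly_def det_def eval_poly_sum eval_poly_mult eval_poly_of_int eval_poly_prod)
qed

end

theory Submission
  imports Defs "HOL-Computational_Algebra.Fundamental_Theorem_Algebra"
begin

text \<open>
  Degree 3: choose a linear basis of the cubic invariants and reduce it. Generic orbits meet a slice on
  which only \<open>D = 9 m - 16\<close> coordinates vary, so \<open>n > D\<close> invariants of degree 3 are algebraically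
  dependent and the map \<open>(f\<^sub>1, \<dots>, f\<^sub>n)\<close> misses a point \<open>a\<close> with no zero coordinate. The image is a cone, so
  the \<open>n - 1\<close> invariants \<open>f\<^sub>i - (a\<^sub>i / a\<^sub>1) f\<^sub>1\<close> have the same zero set.

  Degree 6: the cubic invariants \<open>det (\<Sum>\<^sub>l t\<^sub>l X\<^sub>l)\<close> vanish iff the \<open>X\<^sub>l\<close> span a space of singular
  matrices. Up to equivalence this is a compression space, which a one-parameter subgroup contracts to 0,
  or it consists of skew-symmetric matrices \<open>[y\<^sub>l]\<close> of cross products. In the second case the block determinant
  \<open>g\<^sub>i\<^sub>j\<^sub>k\<close> is nonzero if \<open>y\<^sub>i, y\<^sub>j, y\<^sub>k\<close> are independent; if all of them vanish, then the \<open>y\<^sub>l\<close> lie in a plane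
  and the span is again a compression space.
\<close>

subsection \<open>Evaluation of homogeneous polynomials and of invariants\<close>

text \<open>The number \<open>9 m - 16\<close> is the dimension of the space of tuples minus that of
  \<open>SL_3 x SL_3\<close>. Transcendence degree enters only through a count of monomials on the
  slice; the resulting relation is itself an invariant polynomial, so its vanishing spreads from the
  slice along the orbits and, by continuity, to all tuples. For the null cone, invariants of every
  degree must be shown to vanish. The classification of singular spaces makes this possible: each
  type of compression space supplies one explicit one-parameter subgroup that handles all degrees at
  once. Skew-symmetric matrices are the obstruction to stopping at degree 3: in odd size they are
  always singular, yet a tuple containing three independent ones lies outside the null cone, and
  this is what the \<open>g\<close> detect.\<close>

lemma mon_degree_eq: "mon_degree t = (\<Sum>v\<in>UNIV. Poly_Mapping.lookup t v)"
  for t :: "'v::finite \<Rightarrow>\<^sub>0 nat"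
  unfolding mon_degree_def by (rule sum.mono_neutral_left) (auto simp: in_keys_iff)

lemma mon_degree_add: "mon_degree (s + t) = mon_degree s + mon_degree t"
  for t :: "'v::finite \<Rightarrow>\<^sub>0 nat"
  by (simp add: mon_degree_eq lookup_add sum.distrib)

lemma homogeneous_0 [simp]: "homogeneous d 0"
  by (simp add: homogeneous_def)

lemma homogeneous_add: "homogeneous d f \<Longrightarrow> homogeneous d g \<Longrightarrow> homogeneous d (f + g)"
  unfolding homogeneous_def using keys_add[of f g] by blast

lemma homogeneous_sum: "(\<And>i. i \<in> I \<Longrightarrow> homogeneous d (f i)) \<Longrightarrow> homogeneous d (sum f I)"
  by (induction I rule: infinite_finite_induct) (auto intro: homogeneous_add)

lemma homogeneous_mult: "homogeneous d f \<Longrightarrow> homogeneous e g \<Longrightarrow> homogeneous (d + e) (f * g)"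
  for f :: "('n::finite, 'm::finite) matpoly"
  unfolding homogeneous_def using keys_mult[of f g] by (fastforce simp: mon_degree_add)

lemma homogeneous_const: "homogeneous 0 (Poly_Mapping.single 0 c)"
  by (auto simp: homogeneous_def mon_degree_def)

lemma homogeneous_smult: "homogeneous d f \<Longrightarrow> homogeneous d (Poly_Mapping.single 0 c * f)"
  for f :: "('n::finite, 'm::finite) matpoly"
  using homogeneous_mult[OF homogeneous_const] by fastforce

lemma homogeneous_1: "homogeneous 0 (1 :: ('n, 'm) matpoly)"
  using homogeneous_const[of 1] by simp

lemma homogeneous_of_int: "homogeneous 0 (of_int z :: ('n, 'm) matpoly)"
  using homogeneous_const[of "of_int z"] by simp

lemma homogeneous_prod:
  "(\<And>i. i \<in> I \<Longrightarrow> homogeneous (d i) (f i)) \<Longrightarrow> homogeneous (sum d I) (prod f I)"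
  for f :: "'i \<Rightarrow> ('n::finite, 'm::finite) matpoly"
  by (induction I rule: infinite_finite_induct) (auto intro: homogeneous_mult homogeneous_1)

lemma homogeneous_det:
  fixes A :: "('n::finite, 'm::finite) matpoly^'r^'r"
  assumes "\<And>r c. homogeneous 1 (A $ r $ c)"
  shows "homogeneous CARD('r) (det A)"
proof -
  have "homogeneous (0 + (\<Sum>r\<in>(UNIV::'r set). 1)) (of_int (sign p) * (\<Prod>i\<in>UNIV. A $ i $ p i))" for p
    by (intro homogeneous_mult homogeneous_of_int homogeneous_prod assms)
  then show ?thesis
    unfolding det_def by (intro homogeneous_sum) simp
qed

lemma homogeneous_generic_mat: "homogeneous 1 (generic_mat l $ a $ b)"
  by (auto simp: homogeneous_def generic_mat_def mon_degree_def)

lemma eval_poly_smult: "eval_poly (Poly_Mapping.single 0 c * f) X = c * eval_poly f X"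
  for f :: "('n::finite, 'm::finite) matpoly"
  by (simp add: eval_poly_mult eval_poly_const)

lemma eval_poly_power: "eval_poly (f ^ k) X = eval_poly f X ^ k"
  for f :: "('n::finite, 'm::finite) matpoly"
  by (induction k) (auto simp: eval_poly_mult)

lemma eval_poly_det: "eval_poly (det A) X = det (\<chi> r c. eval_poly (A $ r $ c) X)"
  for A :: "('n::finite, 'm::finite) matpoly^'r^'r"
  by (simp add: det_def eval_poly_sum eval_poly_mult eval_poly_of_int eval_poly_prod)

lemma eval_poly_scale:
  fixes f :: "('n::finite, 'm::finite) matpoly"
  assumes "homogeneous d f"
  shows "eval_poly f (\<chi> l a b. c * X $ l $ a $ b) = c ^ d * eval_poly f X"
proof -
  have "eval_mon t (\<chi> l a b. c * X $ l $ a $ b) = c ^ mon_degree t * eval_mon t X" for t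
    by (simp add: eval_mon_eq mon_degree_eq power_mult_distrib prod.distrib case_prod_unfold power_sum)
  then show ?thesis
    using assms by (auto simp: eval_poly_def homogeneous_def sum_distrib_left intro!: sum.cong)
qed

lemma eval_poly_at_0:
  fixes f :: "('n::finite, 'm::finite) matpoly"
  assumes "homogeneous d f" "d > 0"
  shows "eval_poly f 0 = 0"
proof -
  have "(\<chi> l a b. 0 * (0::complex^'n^'n^'m) $ l $ a $ b) = 0"
    by (simp add: vec_eq_iff)
  then show ?thesis
    using eval_poly_scale[OF assms(1), of 0 0] assms(2) by (simp add: power_0_left)
qed

lemma continuous_eval_poly: "continuous_on UNIV (eval_poly f)"
  for f :: "('n::finite, 'm::finite) matpoly"
  unfolding eval_poly_def eval_mon_eq case_prod_unfold by (intro continuous_intros)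

lemma continuous_on_eval_poly [continuous_intros]:
  "continuous_on S X \<Longrightarrow> continuous_on S (\<lambda>s. eval_poly f (X s))"
  for f :: "('n::finite, 'm::finite) matpoly"
  using continuous_on_compose2[OF continuous_eval_poly] by blast

lemma invariants_smult: "f \<in> invariants \<Longrightarrow> Poly_Mapping.single 0 c * f \<in> invariants"
  by (simp add: invariants_def eval_poly_smult)

lemma invariants_add: "f \<in> invariants \<Longrightarrow> g \<in> invariants \<Longrightarrow> f + g \<in> invariants"
  by (simp add: invariants_def eval_poly_add)

lemma invariants_sum: "(\<And>i. i \<in> I \<Longrightarrow> f i \<in> invariants) \<Longrightarrow> sum f I \<in> invariants"
  by (simp add: invariants_def eval_poly_sum)

lemma invariants_prod: "(\<And>i. i \<in> I \<Longrightarrow> f i \<in> invariants) \<Longrightarrow> prod f I \<in> invariants"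
  by (simp add: invariants_def eval_poly_prod)

lemma invariants_power: "f \<in> invariants \<Longrightarrow> f ^ k \<in> invariants"
  by (simp add: invariants_def eval_poly_power)

lemma matrix_inv_inverse:
  assumes "invertible A"
  shows "A ** matrix_inv A = mat 1" "matrix_inv A ** A = mat 1"
  using someI_ex[OF assms[unfolded invertible_def]] by (auto simp: matrix_inv_def)

lemma matrix_inv_eqI:
  assumes "A ** B = mat 1" "B ** A = mat 1"
  shows "matrix_inv A = B"
proof -
  have "invertible A" using assms by (auto simp: invertible_def)
  then have "matrix_inv A = matrix_inv A ** (A ** B)"
    by (simp add: assms)
  also have "\<dots> = B"
    by (simp add: matrix_mul_assoc matrix_inv_inverse \<open>invertible A\<close>)
  finally show ?thesis .
qed

lemma det_matrix_inv: "invertible A \<Longrightarrow> det A * det (matrix_inv A) = 1"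
  for A :: "'a::comm_ring_1^'n::finite^'n"
  by (metis det_I det_mul matrix_inv_inverse(1))

text \<open>Inversion maps \<open>SL\<close> onto itself, so the right factor may be any matrix of
  determinant 1. The later changes of basis use this inverse-free form.\<close>

lemma eval_act:
  fixes A B :: "complex^'n::finite^'n" and X :: "complex^'n^'n^'m::finite"
  assumes "f \<in> invariants" "det A = 1" "det B = 1"
  shows "eval_poly f (\<chi> l. A ** X $ l ** B) = eval_poly f X"
proof -
  have B: "invertible B" using assms by (simp add: invertible_det_nz)
  then have "det (matrix_inv B) = 1"
    using det_matrix_inv[OF B] assms by simp
  moreover have "matrix_inv (matrix_inv B) = B"
    by (intro matrix_inv_eqI matrix_inv_inverse B)
  ultimately show ?thesis
    using assms unfolding invariants_def SL_def act_def by force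
qed

lemma invariants_of_degree_lincomb:
  "f \<in> invariants_of_degree d \<Longrightarrow> g \<in> invariants_of_degree d \<Longrightarrow>
   f + Poly_Mapping.single 0 c * g \<in> invariants_of_degree d"
  by (simp add: invariants_of_degree_def invariants_add invariants_smult homogeneous_add homogeneous_smult)

subsection \<open>Determinants of block matrices and basic invariants\<close>

lemma block_mat_sel [simp]:
  "block_mat P Q R S $ Inl a $ Inl b = P $ a $ b"
  "block_mat P Q R S $ Inl a $ Inr b = Q $ a $ b"
  "block_mat P Q R S $ Inr a $ Inl b = R $ a $ b"
  "block_mat P Q R S $ Inr a $ Inr b = S $ a $ b"
  by (simp_all add: block_mat_def)

lemma sum_UNIV_Plus: "sum f (UNIV :: ('a::finite + 'b::finite) set) = (\<Sum>a\<in>UNIV. f (Inl a)) + (\<Sum>b\<in>UNIV. f (Inr b))"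
  by (simp flip: UNIV_Plus_UNIV add: sum.Plus)

lemma prod_UNIV_Plus: "prod f (UNIV :: ('a::finite + 'b::finite) set) = (\<Prod>a\<in>UNIV. f (Inl a)) * (\<Prod>b\<in>UNIV. f (Inr b))"
  by (simp flip: UNIV_Plus_UNIV add: prod.Plus)

lemma vec_sum_eq_iff:
  "(x :: 'a^('n::finite + 'k::finite)) = y \<longleftrightarrow> (\<forall>i. x $ Inl i = y $ Inl i) \<and> (\<forall>i. x $ Inr i = y $ Inr i)"
  by (simp add: vec_eq_iff) (metis sum.exhaust)

lemma block_mat_mult:
  fixes P :: "'a::semiring_1^'n::finite^'n"
  shows "block_mat P Q R S ** block_mat P' Q' R' S' =
    block_mat (P ** P' + Q ** R') (P ** Q' + Q ** S') (R ** P' + S ** R') (R ** Q' + S ** S')"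
  by (simp add: vec_sum_eq_iff matrix_matrix_mult_def sum_UNIV_Plus)

lemma permutationI: "p permutes (UNIV :: 'a::finite set) \<Longrightarrow> permutation p"
  unfolding permutation_permutes by (metis finite_class.finite_UNIV)

text \<open>Splitting \<open>map_sum p q\<close> into a permutation of each summand reduces the sign
  to an induction over transpositions, which \<open>Inl\<close> and \<open>Inr\<close> embed as
  transpositions.\<close>

lemma sign_map_sum:
  fixes p :: "'a::finite \<Rightarrow> 'a" and q :: "'b::finite \<Rightarrow> 'b"
  assumes "p permutes UNIV" "q permutes UNIV"
  shows "sign (map_sum p q) = sign p * sign q" "map_sum p q permutes UNIV"
proof -
  have L: "map_sum p (id :: 'b \<Rightarrow> 'b) permutes UNIV \<and> sign (map_sum p (id :: 'b \<Rightarrow> 'b)) = sign p"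
    using assms(1) finite_class.finite_UNIV
  proof (induction rule: permutes_induct)
    case (swap a b p)
    have eq: "map_sum (Transposition.transpose a b \<circ> p) (id :: 'b \<Rightarrow> 'b)
        = Transposition.transpose (Inl a) (Inl b) \<circ> map_sum p id"
      by (rule ext, rename_tac x, case_tac x) (auto simp: Transposition.transpose_def)
    have pp: "permutation p" "permutation (map_sum p (id :: 'b \<Rightarrow> 'b))"
      using swap by (blast intro: permutationI)+
    show ?case
      unfolding eq sign_compose[OF permutation_swap_id pp(2)] sign_compose[OF permutation_swap_id pp(1)] sign_swap_id
      using swap by (intro conjI permutes_compose permutes_swap_id) (simp_all add: id_def)
  qed (simp only: sum.map_id0 sign_id permutes_id simp_thms)
  have R: "map_sum (id :: 'a \<Rightarrow> 'a) q permutes UNIV \<and> sign (map_sum (id :: 'a \<Rightarrow> 'a) q) = sign q"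
    using assms(2) finite_class.finite_UNIV
  proof (induction rule: permutes_induct)
    case (swap a b p)
    have eq: "map_sum (id :: 'a \<Rightarrow> 'a) (Transposition.transpose a b \<circ> p)
        = Transposition.transpose (Inr a) (Inr b) \<circ> map_sum id p"
      by (rule ext, rename_tac x, case_tac x) (auto simp: Transposition.transpose_def)
    have pp: "permutation p" "permutation (map_sum (id :: 'a \<Rightarrow> 'a) p)"
      using swap by (blast intro: permutationI)+
    show ?case
      unfolding eq sign_compose[OF permutation_swap_id pp(2)] sign_compose[OF permutation_swap_id pp(1)] sign_swap_id
      using swap by (intro conjI permutes_compose permutes_swap_id) (simp_all add: id_def)
  qed (simp only: sum.map_id0 sign_id permutes_id simp_thms)
  have eq: "map_sum p q = map_sum p id \<circ> map_sum id q"
    by (simp add: map_sum.comp)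
  have pp: "permutation (map_sum p (id :: 'b \<Rightarrow> 'b))" "permutation (map_sum (id :: 'a \<Rightarrow> 'a) q)"
    using L R by (blast intro: permutationI)+
  show "sign (map_sum p q) = sign p * sign q"
    unfolding eq by (simp add: sign_compose[OF pp] L R)
  show "map_sum p q permutes UNIV"
    unfolding eq using L R by (auto intro: permutes_compose)
qed

text \<open>A nonzero Leibniz term uses only entries of the two diagonal blocks, so its permutation
  preserves both summands of the index type and has the form \<open>map_sum r s\<close>.\<close>

lemma det_block_diag:
  fixes A D :: "'a::comm_ring_1^'n::finite^'n"
  shows "det (block_mat A 0 0 D) = det A * det D"
proof -
  let ?U = "UNIV :: 'n set" and ?V = "UNIV :: ('n + 'n) set"
  let ?P = "{p. p permutes ?U}"
  let ?B = "block_mat A 0 0 D"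
  let ?t = "\<lambda>p. of_int (sign p) * (\<Prod>i\<in>UNIV. ?B $ i $ p i)"
  let ?h = "\<lambda>(p, q). map_sum p q"
  have "det ?B = sum ?t (?h ` (?P \<times> ?P))"
    unfolding det_def
  proof (rule sum.mono_neutral_right)
    show "finite {p. p permutes ?V}" by (simp add: finite_permutations)
    show "?h ` (?P \<times> ?P) \<subseteq> {p. p permutes ?V}"
      by (auto intro: sign_map_sum)
    show "\<forall>p\<in>{p. p permutes ?V} - ?h ` (?P \<times> ?P). ?t p = 0"
    proof (rule ballI, rule ccontr)
      fix p assume p: "p \<in> {p. p permutes ?V} - ?h ` (?P \<times> ?P)" and "?t p \<noteq> 0"
      then have "(\<Prod>i\<in>UNIV. ?B $ i $ p i) \<noteq> 0" by auto
      then have nz: "?B $ i $ p i \<noteq> 0" for i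
        by (metis (no_types, lifting) UNIV_I finite_class.finite_UNIV prod_zero)
      have "\<exists>b. p (Inl a) = Inl b" for a
        using nz[of "Inl a"] by (cases "p (Inl a)") auto
      then obtain r where r: "\<And>a. p (Inl a) = Inl (r a)" by metis
      have "\<exists>b. p (Inr a) = Inr b" for a
        using nz[of "Inr a"] by (cases "p (Inr a)") auto
      then obtain s where s: "\<And>a. p (Inr a) = Inr (s a)" by metis
      have eq: "p = map_sum r s"
        by (rule ext, rename_tac x, case_tac x) (auto simp: r s)
      have "inj p" using p by (auto intro: permutes_inj)
      then have "inj r" "inj s"
        by (auto simp: inj_def) (metis r sum.inject(1), metis s sum.inject(2))
      then have "r permutes ?U" "s permutes ?U"
        by (auto intro!: bij_imp_permutes simp: bij_def finite_UNIV_inj_surj)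
      then show False using p eq by auto
    qed
  qed
  also have "\<dots> = (\<Sum>(p, q)\<in>?P \<times> ?P. ?t (map_sum p q))"
  proof (subst sum.reindex)
    show "inj_on ?h (?P \<times> ?P)"
      by (auto simp: inj_on_def fun_eq_iff) (metis map_sum.simps(1) sum.inject(1), metis map_sum.simps(2) sum.inject(2))
  qed (auto simp: case_prod_unfold intro!: sum.cong)
  also have "\<dots> = (\<Sum>(p, q)\<in>?P \<times> ?P. (of_int (sign p) * (\<Prod>i\<in>UNIV. A $ i $ p i)) *
      (of_int (sign q) * (\<Prod>i\<in>UNIV. D $ i $ q i)))"
    by (intro sum.cong) (auto simp: sign_map_sum prod_UNIV_Plus mult_ac)
  also have "\<dots> = det A * det D"
    by (simp add: det_def sum_product sum.cartesian_product)
  finally show ?thesis .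
qed

lemma act_nth: "act A B X $ l = A ** X $ l ** matrix_inv B"
  by (simp add: act_def)

lemma det_matrix_inv_SL:
  assumes "B \<in> SL" shows "det (matrix_inv B) = 1"
  using assms det_matrix_inv[of B] by (simp add: SL_def invertible_det_nz)

text \<open>The action multiplies the block matrix by \<open>diag(A, A)\<close> on the left and
  \<open>diag(B^-1, B^-1)\<close> on the right, both of determinant 1.\<close>

lemma g_poly_invariant:
  "(g_poly i j k :: ('n::finite, 'm::finite) matpoly) \<in> invariants_of_degree (2 * CARD('n))"
proof -
  have "homogeneous 1 (block_mat (generic_mat j) (generic_mat i) (generic_mat i) (generic_mat k) $ r $ c
      :: ('n, 'm) matpoly)" for r c :: "'n + 'n"
    by (cases r; cases c) (auto simp: homogeneous_generic_mat[simplified])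
  then have "homogeneous CARD('n + 'n) (g_poly i j k :: ('n, 'm) matpoly)"
    unfolding g_poly_def by (intro homogeneous_det)
  moreover have "eval_poly (g_poly i j k) (act A B X) = eval_poly (g_poly i j k) X"
    if "A \<in> SL" "B \<in> SL" for A B and X :: "complex^'n^'n^'m"
  proof -
    have "block_mat (act A B X $ j) (act A B X $ i) (act A B X $ i) (act A B X $ k)
      = block_mat A 0 0 A ** block_mat (X $ j) (X $ i) (X $ i) (X $ k)
         ** block_mat (matrix_inv B) 0 0 (matrix_inv B)"
      by (simp add: block_mat_mult act_nth)
    then show ?thesis
      using that by (simp add: eval_g_poly det_mul det_block_diag det_matrix_inv_SL) (simp add: SL_def)
  qed
  ultimately show ?thesis
    by (simp add: invariants_of_degree_def invariants_def mult_2)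
qed

section \<open>Determinants of linear combinations as invariants\<close>

definition lincomb :: "('m \<Rightarrow> complex) \<Rightarrow> complex^'n::finite^'n^'m::finite \<Rightarrow> complex^'n^'n" where
  "lincomb t X = (\<chi> a b. \<Sum>l\<in>UNIV. t l * X $ l $ a $ b)"

text \<open>Letting the scalars \<open>t\<close> vary replaces extracting the coefficients of
  \<open>det (lincomb t X)\<close> in \<open>t\<close>, and turns the vanishing of these invariants
  into a statement about all matrices in a linear span.\<close>

definition pencil_poly :: "('m \<Rightarrow> complex) \<Rightarrow> ('n::finite, 'm::finite) matpoly" where
  "pencil_poly t = det (\<chi> a b. \<Sum>l\<in>UNIV. Poly_Mapping.single 0 (t l) * generic_mat l $ a $ b)"

lemma eval_pencil_poly: "eval_poly (pencil_poly t) X = det (lincomb t X)"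
  by (simp add: pencil_poly_def lincomb_def eval_poly_det eval_poly_sum eval_poly_smult eval_generic_mat)

lemma lincomb_mult: "lincomb t (\<chi> l. A ** X $ l ** B) = A ** lincomb t X ** B"
  by (simp add: vec_eq_iff lincomb_def matrix_matrix_mult_def sum_distrib_left sum_distrib_right)
     (intro allI; subst sum.swap, rule sum.cong, simp, subst sum.swap, simp add: mult_ac)

lemma pencil_poly_invariant:
  "(pencil_poly t :: ('n::finite, 'm::finite) matpoly) \<in> invariants_of_degree CARD('n)"
proof -
  have "homogeneous CARD('n) (pencil_poly t :: ('n, 'm) matpoly)"
    unfolding pencil_poly_def
    by (intro homogeneous_det) (simp add: homogeneous_sum homogeneous_smult homogeneous_generic_mat[simplified])
  moreover have "eval_poly (pencil_poly t) (act A B X) = eval_poly (pencil_poly t) X"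
    if "A \<in> SL" "B \<in> SL" for A B and X :: "complex^'n^'n^'m"
    using that by (simp add: eval_pencil_poly act_def lincomb_mult det_mul det_matrix_inv_SL) (simp add: SL_def)
  ultimately show ?thesis
    by (simp add: invariants_of_degree_def invariants_def)
qed

subsection \<open>Linear algebra\<close>

lemma finite_mon_degree: "finite {t :: 'v::finite \<Rightarrow>\<^sub>0 nat. mon_degree t = d}"
proof (rule finite_imageD)
  have "Poly_Mapping.lookup t v \<le> mon_degree t" for t :: "'v \<Rightarrow>\<^sub>0 nat" and v
    unfolding mon_degree_eq by (rule member_le_sum) auto
  then have "Poly_Mapping.lookup ` {t :: 'v \<Rightarrow>\<^sub>0 nat. mon_degree t = d} \<subseteq> (\<Pi>\<^sub>E v\<in>UNIV. {..d})"
    by auto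
  then show "finite (Poly_Mapping.lookup ` {t :: 'v \<Rightarrow>\<^sub>0 nat. mon_degree t = d})"
    by (rule finite_subset) (intro finite_PiE; simp)
  show "inj_on Poly_Mapping.lookup {t :: 'v \<Rightarrow>\<^sub>0 nat. mon_degree t = d}"
    by (simp add: inj_on_def poly_mapping_eqI)
qed

interpretation mp: vector_space "\<lambda>c (f :: ('n::finite, 'm::finite) matpoly). Poly_Mapping.single 0 c * f"
proof
  fix a b :: complex and f g :: "('n, 'm) matpoly"
  show "Poly_Mapping.single 0 a * (Poly_Mapping.single 0 b * f) = Poly_Mapping.single 0 (a * b) * f"
    by (simp add: mult_single flip: mult.assoc)
  show "Poly_Mapping.single 0 (a + b) * f = Poly_Mapping.single 0 a * f + Poly_Mapping.single 0 b * f"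
    by (simp add: single_add ring_distribs)
qed (simp_all add: ring_distribs)

lemma homogeneous_in_span:
  assumes "homogeneous d (f :: ('n::finite, 'm::finite) matpoly)"
  shows "f \<in> mp.span ((\<lambda>t. Poly_Mapping.single t 1) ` {t. mon_degree t = d})"
proof -
  have "f = (\<Sum>t\<in>Poly_Mapping.keys f. Poly_Mapping.single 0 (Poly_Mapping.lookup f t) * Poly_Mapping.single t 1)"
    by (rule poly_mapping_eqI) (auto simp: mult_single lookup_sum lookup_single when_def sum.delta in_keys_iff)
  also have "\<dots> \<in> mp.span ((\<lambda>t. Poly_Mapping.single t 1) ` {t. mon_degree t = d})"
    using assms by (intro mp.span_sum mp.span_scale mp.span_base) (auto simp: homogeneous_def)
  finally show ?thesis .
qed

lemma eval_poly_span:
  assumes "f \<in> mp.span F" "\<And>g. g \<in> F \<Longrightarrow> eval_poly g X = 0"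
  shows "eval_poly f X = 0"
  using assms(1)
  by (induction rule: mp.span_induct_alt) (auto simp: assms eval_poly_add eval_poly_smult)

text \<open>Forms of degree \<open>d\<close> lie in a finite-dimensional space, so a maximal
  independent subset of \<open>W\<close> is finite, and everything in its span vanishes where it
  does.\<close>

lemma finite_defining_subset:
  fixes W :: "('n::finite, 'm::finite) matpoly set"
  assumes "\<And>f. f \<in> W \<Longrightarrow> homogeneous d f"
  obtains F where "finite F" "F \<subseteq> W" "zero_set F = zero_set W"
proof -
  obtain F where F: "F \<subseteq> W" "mp.independent F" "W \<subseteq> mp.span F"
    using mp.maximal_independent_subset by blast
  have "F \<subseteq> mp.span ((\<lambda>t. Poly_Mapping.single t 1) ` {t. mon_degree t = d})"
    using F(1) assms homogeneous_in_span by blast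
  then have "finite F"
    using mp.independent_span_bound[OF finite_imageI[OF finite_mon_degree] F(2)] by blast
  moreover have "zero_set F = zero_set W"
    using F eval_poly_span by (fastforce simp: zero_set_def)
  ultimately show ?thesis using that F(1) by blast
qed

lemma homogeneous_system_nontrivial:
  fixes c :: "'a \<Rightarrow> 'b \<Rightarrow> 'k::field"
  assumes "finite B" "finite A" "card B < card A"
  shows "\<exists>u. (\<exists>a\<in>A. u a \<noteq> 0) \<and> (\<forall>b\<in>B. (\<Sum>a\<in>A. u a * c a b) = 0)"
  using assms
proof (induction B arbitrary: A c rule: finite_induct)
  case empty
  then obtain a where "a \<in> A" by fastforce
  then show ?case by (intro exI[of _ "\<lambda>_. 1"]) auto
next
  case (insert b B)
  show ?case
  proof (cases "\<forall>a\<in>A. c a b = 0")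
    case True
    obtain u where "\<exists>a\<in>A. u a \<noteq> 0" "\<forall>b\<in>B. (\<Sum>a\<in>A. u a * c a b) = 0"
      using insert.IH[of A c] insert.hyps insert.prems by (metis Suc_lessD card_insert_disjoint)
    then show ?thesis using True by (intro exI[of _ u]) auto
  next
    case False
    then obtain a0 where a0: "a0 \<in> A" "c a0 b \<noteq> 0" by blast
    \<comment> \<open>Solving equation \<open>b\<close> for the unknown \<open>a0\<close> and
      substituting into equation \<open>b'\<close> leaves these coefficients for the other
      unknowns.\<close>
    define c' where "c' a b' = c a b' - c a b / c a0 b * c a0 b'" for a b'
    have "card B < card (A - {a0})"
      using insert a0 by simp
    then obtain u where u: "\<exists>a\<in>A - {a0}. u a \<noteq> 0" "\<And>b'. b' \<in> B \<Longrightarrow> (\<Sum>a\<in>A - {a0}. u a * c' a b') = 0"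
      using insert.IH[of "A - {a0}" c'] insert.prems by auto
    define s where "s = (\<Sum>a\<in>A - {a0}. u a * c a b)"
    define v where "v = u(a0 := - s / c a0 b)"
    have sum: "(\<Sum>a\<in>A. v a * c a b') = - s / c a0 b * c a0 b' + (\<Sum>a\<in>A - {a0}. u a * c a b')" for b'
    proof -
      have "(\<Sum>a\<in>A. v a * c a b') = v a0 * c a0 b' + (\<Sum>a\<in>A - {a0}. v a * c a b')"
        using insert.prems a0 by (intro sum.remove)
      also have "(\<Sum>a\<in>A - {a0}. v a * c a b') = (\<Sum>a\<in>A - {a0}. u a * c a b')"
        by (intro sum.cong) (auto simp: v_def)
      finally show ?thesis by (simp add: v_def)
    qed
    have "(\<Sum>a\<in>A. v a * c a b') = 0" if "b' \<in> B" for b'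
    proof -
      have "(\<Sum>a\<in>A - {a0}. u a * c' a b') = (\<Sum>a\<in>A - {a0}. u a * c a b') - s / c a0 b * c a0 b'"
        by (simp add: c'_def s_def right_diff_distrib sum_subtractf sum_divide_distrib sum_distrib_right mult.assoc)
      then show ?thesis using u(2)[OF that] sum[of b'] by simp
    qed
    moreover have "(\<Sum>a\<in>A. v a * c a b) = 0"
      using sum[of b] a0 by (simp add: s_def)
    moreover have "\<exists>a\<in>A. v a \<noteq> 0"
      using u(1) by (auto simp: v_def)
    ultimately show ?thesis by (intro exI[of _ v]) auto
  qed
qed

subsection \<open>Algebraic dependence\<close>

text \<open>The degree is bounded in each coordinate separately: the exponents then fill a box with
  \<open>(d + 1) ^ card J\<close> points, which is the dimension count of
  \<open>algebraic_relation\<close>. Agreement is asked on \<open>S\<close> alone, since the free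
  coordinates determine a tuple only on the slice.\<close>

definition poly_on :: "'x set \<Rightarrow> 'j set \<Rightarrow> ('x \<Rightarrow> 'j \<Rightarrow> complex) \<Rightarrow> nat \<Rightarrow> ('x \<Rightarrow> complex) \<Rightarrow> bool" where
  "poly_on S J y d p \<longleftrightarrow>
    (\<exists>c. \<forall>x\<in>S. p x = (\<Sum>e\<in>(\<Pi>\<^sub>E j\<in>J. {..d}). c e * (\<Prod>j\<in>J. y x j ^ e j)))"

lemma poly_on_cong: "(\<And>x. x \<in> S \<Longrightarrow> p x = q x) \<Longrightarrow> poly_on S J y d p = poly_on S J y d q"
  by (simp add: poly_on_def)

lemma poly_on_0: "poly_on S J y d (\<lambda>x. 0)"
  unfolding poly_on_def by (intro exI[of _ "\<lambda>_. 0"]) simp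

lemma poly_on_add:
  assumes "poly_on S J y d p" "poly_on S J y d q"
  shows "poly_on S J y d (\<lambda>x. p x + q x)"
proof -
  obtain c c' where "\<forall>x\<in>S. p x = (\<Sum>e\<in>(\<Pi>\<^sub>E j\<in>J. {..d}). c e * (\<Prod>j\<in>J. y x j ^ e j))"
    "\<forall>x\<in>S. q x = (\<Sum>e\<in>(\<Pi>\<^sub>E j\<in>J. {..d}). c' e * (\<Prod>j\<in>J. y x j ^ e j))"
    using assms unfolding poly_on_def by blast
  then show ?thesis
    unfolding poly_on_def by (intro exI[of _ "\<lambda>e. c e + c' e"]) (simp add: ring_distribs sum.distrib)
qed

lemma poly_on_cmult:
  assumes "poly_on S J y d p"
  shows "poly_on S J y d (\<lambda>x. a * p x)"
proof -
  obtain c where "\<forall>x\<in>S. p x = (\<Sum>e\<in>(\<Pi>\<^sub>E j\<in>J. {..d}). c e * (\<Prod>j\<in>J. y x j ^ e j))"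
    using assms unfolding poly_on_def by blast
  then show ?thesis
    unfolding poly_on_def by (intro exI[of _ "\<lambda>e. a * c e"]) (simp add: sum_distrib_left mult_ac)
qed

lemma poly_on_sum:
  "(\<And>i. i \<in> I \<Longrightarrow> poly_on S J y d (p i)) \<Longrightarrow> poly_on S J y d (\<lambda>x. \<Sum>i\<in>I. p i x)"
  by (induction I rule: infinite_finite_induct) (auto intro: poly_on_add poly_on_0)

lemma poly_on_monomial:
  assumes "finite J" "\<And>j. j \<in> J \<Longrightarrow> e j \<le> d"
  shows "poly_on S J y d (\<lambda>x. \<Prod>j\<in>J. y x j ^ e j)"
proof -
  \<comment> \<open>Members of the index set are \<open>undefined\<close> outside \<open>J\<close>,
    so the coefficient must select \<open>restrict e J\<close> rather than \<open>e\<close>.\<close>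
  have "(\<Sum>e'\<in>(\<Pi>\<^sub>E j\<in>J. {..d}). (if e' = restrict e J then 1 else 0) * (\<Prod>j\<in>J. y x j ^ e' j))
      = (\<Prod>j\<in>J. y x j ^ e j)" for x
  proof -
    have "(\<Sum>e'\<in>(\<Pi>\<^sub>E j\<in>J. {..d}). (if e' = restrict e J then 1 else 0) * (\<Prod>j\<in>J. y x j ^ e' j))
      = (\<Sum>e'\<in>(\<Pi>\<^sub>E j\<in>J. {..d}). if e' = restrict e J then (\<Prod>j\<in>J. y x j ^ e' j) else 0)"
      by (intro sum.cong) auto
    also have "\<dots> = (\<Prod>j\<in>J. y x j ^ restrict e J j)"
      using assms by (subst sum.delta) (auto simp: finite_PiE)
    finally show ?thesis by simp
  qed
  then show ?thesis
    unfolding poly_on_def by (intro exI[of _ "\<lambda>e'. if e' = restrict e J then 1 else 0"]) simp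
qed

lemma poly_on_mult:
  assumes "finite J" "poly_on S J y d p" "poly_on S J y d' q"
  shows "poly_on S J y (d + d') (\<lambda>x. p x * q x)"
proof -
  obtain c c' where c: "\<forall>x\<in>S. p x = (\<Sum>e\<in>(\<Pi>\<^sub>E j\<in>J. {..d}). c e * (\<Prod>j\<in>J. y x j ^ e j))"
    "\<forall>x\<in>S. q x = (\<Sum>e\<in>(\<Pi>\<^sub>E j\<in>J. {..d'}). c' e * (\<Prod>j\<in>J. y x j ^ e j))"
    using assms unfolding poly_on_def by blast
  have "poly_on S J y (d + d') (\<lambda>x. \<Sum>e\<in>(\<Pi>\<^sub>E j\<in>J. {..d}). \<Sum>e'\<in>(\<Pi>\<^sub>E j\<in>J. {..d'}).
      (c e * c' e') * (\<Prod>j\<in>J. y x j ^ (e j + e' j)))"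
  proof (intro poly_on_sum poly_on_cmult poly_on_monomial assms(1))
    fix e e' j assume "e \<in> (\<Pi>\<^sub>E j\<in>J. {..d})" "e' \<in> (\<Pi>\<^sub>E j\<in>J. {..d'})" "j \<in> J"
    then show "e j + e' j \<le> d + d'" by (intro add_mono) auto
  qed
  moreover have "p x * q x = (\<Sum>e\<in>(\<Pi>\<^sub>E j\<in>J. {..d}). \<Sum>e'\<in>(\<Pi>\<^sub>E j\<in>J. {..d'}).
      (c e * c' e') * (\<Prod>j\<in>J. y x j ^ (e j + e' j)))" if "x \<in> S" for x
    using c that by (simp add: sum_product power_add prod.distrib) (simp add: mult_ac)
  ultimately show ?thesis
    by (simp cong: poly_on_cong)
qed

lemma poly_on_mono:
  assumes "finite J" "poly_on S J y d p" "d \<le> d'"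
  shows "poly_on S J y d' p"
proof -
  obtain c where c: "\<forall>x\<in>S. p x = (\<Sum>e\<in>(\<Pi>\<^sub>E j\<in>J. {..d}). c e * (\<Prod>j\<in>J. y x j ^ e j))"
    using assms unfolding poly_on_def by blast
  have "poly_on S J y d' (\<lambda>x. \<Sum>e\<in>(\<Pi>\<^sub>E j\<in>J. {..d}). c e * (\<Prod>j\<in>J. y x j ^ e j))"
  proof (intro poly_on_sum poly_on_cmult poly_on_monomial assms(1))
    fix e j assume "e \<in> (\<Pi>\<^sub>E j\<in>J. {..d})" "j \<in> J"
    then have "e j \<le> d" by auto
    then show "e j \<le> d'" using assms by simp
  qed
  then show ?thesis using c by (simp cong: poly_on_cong)
qed

lemma poly_on_const: "finite J \<Longrightarrow> poly_on S J y d (\<lambda>x. a)"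
  using poly_on_cmult[OF poly_on_monomial[of J "\<lambda>_. 0" d S y], of a] by simp

lemma poly_on_coordinate:
  assumes "finite J" "j \<in> J"
  shows "poly_on S J y 1 (\<lambda>x. y x j)"
proof -
  have "(\<Prod>i\<in>J. y x i ^ (if i = j then 1 else 0)) = y x j" for x
  proof -
    have "(\<Prod>i\<in>J. y x i ^ (if i = j then 1 else 0)) = (\<Prod>i\<in>J. if i = j then y x i else 1)"
      by (intro prod.cong) auto
    then show ?thesis using assms by simp
  qed
  then show ?thesis
    using poly_on_monomial[of J "\<lambda>i. if i = j then 1 else 0" 1 S y] assms by simp
qed

lemma poly_on_prod:
  assumes "finite J" "\<And>i. i \<in> I \<Longrightarrow> poly_on S J y (d i) (p i)"
  shows "poly_on S J y (sum d I) (\<lambda>x. \<Prod>i\<in>I. p i x)"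
  using assms by (induction I rule: infinite_finite_induct) (auto intro: poly_on_mult poly_on_const)

lemma poly_on_power:
  assumes "finite J" "poly_on S J y d p"
  shows "poly_on S J y (k * d) (\<lambda>x. p x ^ k)"
  using poly_on_prod[of J "{..<k}" S y "\<lambda>_. d" "\<lambda>_. p"] assms by simp

lemma poly_on_eval_poly:
  fixes f :: "('n::finite, 'm::finite) matpoly"
  assumes "finite J" "homogeneous d f"
    and "\<And>l a b. poly_on S J y 1 (\<lambda>X. X $ l $ a $ b)"
  shows "poly_on S J y d (eval_poly f)"
  unfolding eval_poly_def
proof (intro poly_on_sum poly_on_cmult)
  fix t assume t: "t \<in> Poly_Mapping.keys f"
  have "poly_on S J y (\<Sum>v\<in>UNIV. Poly_Mapping.lookup t v * 1)
     (\<lambda>X. \<Prod>v\<in>UNIV. (X $ fst v $ fst (snd v) $ snd (snd v)) ^ Poly_Mapping.lookup t v)"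
    by (intro poly_on_prod poly_on_power assms)
  moreover have "(\<Sum>v\<in>UNIV. Poly_Mapping.lookup t v * 1) = d"
    using assms(2) t by (simp add: homogeneous_def mon_degree_eq)
  moreover have "eval_mon t = (\<lambda>X :: complex^'n^'n^'m.
      \<Prod>v\<in>UNIV. (X $ fst v $ fst (snd v) $ snd (snd v)) ^ Poly_Mapping.lookup t v)"
    by (rule ext) (simp add: eval_mon_eq case_prod_unfold)
  ultimately show "poly_on S J y d (eval_mon t)"
    by (simp only:)
qed

lemma sum_digits: "(\<Sum>i<n. (j div K ^ i mod K) * K ^ i) = j mod K ^ n" for j K :: nat
proof (induction n)
  case (Suc n)
  have "j mod K ^ Suc n = j mod (K ^ n * K)" by (simp add: mult.commute)
  also have "\<dots> = (j div K ^ n mod K) * K ^ n + j mod K ^ n"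
    by (simp add: mod_mult2_eq)
  finally show ?case using Suc by simp
qed simp

text \<open>The \<open>K ^ n\<close> monomials in the \<open>f i\<close> with exponents below \<open>K\<close>, which are indexed by the base \<open>K\<close>
  digits of \<open>j\<close>, lie in a space whose dimension grows like \<open>K ^ card J\<close>.\<close>

lemma algebraic_relation:
  fixes f :: "nat \<Rightarrow> 'x \<Rightarrow> complex"
  assumes "finite J" "\<And>i. i < n \<Longrightarrow> poly_on S J y d (f i)" "card J < n"
  obtains K u where "K > 0" "\<exists>j<K ^ n. u j \<noteq> 0"
    "\<And>x. x \<in> S \<Longrightarrow> (\<Sum>j<K ^ n. u j * (\<Prod>i<n. f i x ^ (j div K ^ i mod K))) = 0"
proof -
  define D where "D = card J"
  \<comment> \<open>Chosen so that \<open>(M + 1) ^ D < K ^ n\<close>: the left side is at most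
    \<open>(d * n + 1) ^ D * K ^ D = (K - 1) * K ^ D\<close>, and \<open>n\<close> is at least
    \<open>D + 1\<close>.\<close>
  define K where "K = (d * n + 1) ^ D + 1"
  define M where "M = d * n * K"
  have K: "K > 0" by (simp add: K_def)
  have "M + 1 \<le> (d * n + 1) * K"
    using K by (simp add: M_def)
  then have "(M + 1) ^ D \<le> ((d * n + 1) * K) ^ D"
    by (rule power_mono) simp
  also have "\<dots> = (K - 1) * K ^ D"
    by (simp only: K_def power_mult_distrib add_diff_cancel_right')
  also have "\<dots> < K * K ^ D"
    using K by simp
  also have "\<dots> = K ^ Suc D" by simp
  also have "\<dots> \<le> K ^ n"
    using assms(3) K by (intro power_increasing) (auto simp: D_def)
  finally have lt: "card (\<Pi>\<^sub>E j\<in>J. {..M}) < card {..<K ^ n}"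
    using assms(1) by (simp add: card_PiE D_def)
  have "poly_on S J y M (\<lambda>x. \<Prod>i<n. f i x ^ (j div K ^ i mod K))" for j
  proof (rule poly_on_mono)
    show "poly_on S J y (\<Sum>i<n. (j div K ^ i mod K) * d) (\<lambda>x. \<Prod>i<n. f i x ^ (j div K ^ i mod K))"
      by (intro poly_on_prod poly_on_power assms) auto
    have "(\<Sum>i<n. (j div K ^ i mod K) * d) \<le> (\<Sum>i<n. K * d)"
      using K by (intro sum_mono mult_right_mono) (auto simp: less_imp_le)
    then show "(\<Sum>i<n. (j div K ^ i mod K) * d) \<le> M"
      by (simp add: M_def mult_ac)
  qed (rule assms)
  then have "\<forall>j. \<exists>c. \<forall>x\<in>S. (\<Prod>i<n. f i x ^ (j div K ^ i mod K))
      = (\<Sum>e\<in>(\<Pi>\<^sub>E j\<in>J. {..M}). c e * (\<Prod>j\<in>J. y x j ^ e j))"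
    unfolding poly_on_def by blast
  from choice[OF this] obtain c where c: "\<And>j x. x \<in> S \<Longrightarrow> (\<Prod>i<n. f i x ^ (j div K ^ i mod K))
      = (\<Sum>e\<in>(\<Pi>\<^sub>E j\<in>J. {..M}). c j e * (\<Prod>j\<in>J. y x j ^ e j))"
    by blast
  obtain u where u: "\<exists>j\<in>{..<K ^ n}. u j \<noteq> 0" "\<forall>e\<in>(\<Pi>\<^sub>E j\<in>J. {..M}). (\<Sum>j<K ^ n. u j * c j e) = 0"
    using homogeneous_system_nontrivial[OF _ _ lt, of c] assms(1) by (auto simp: finite_PiE)
  show ?thesis
  proof (rule that[OF K])
    show "\<exists>j<K ^ n. u j \<noteq> 0" using u by auto
    fix x assume x: "x \<in> S"
    have "(\<Sum>j<K ^ n. u j * (\<Prod>i<n. f i x ^ (j div K ^ i mod K)))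
      = (\<Sum>j<K ^ n. \<Sum>e\<in>(\<Pi>\<^sub>E j\<in>J. {..M}). u j * c j e * (\<Prod>j\<in>J. y x j ^ e j))"
      by (simp add: c[OF x] sum_distrib_left mult.assoc)
    also have "\<dots> = (\<Sum>e\<in>(\<Pi>\<^sub>E j\<in>J. {..M}). (\<Sum>j<K ^ n. u j * c j e) * (\<Prod>j\<in>J. y x j ^ e j))"
      by (subst sum.swap) (simp add: sum_distrib_right)
    also have "\<dots> = 0" using u(2) by simp
    finally show "(\<Sum>j<K ^ n. u j * (\<Prod>i<n. f i x ^ (j div K ^ i mod K))) = 0" .
  qed
qed

subsection \<open>A slice for the group action\<close>

text \<open>A nonzero polynomial has finitely many roots, so its nonvanishing locus is dense. This
  is the passage from generic to arbitrary tuples: deform along a parameter \<open>s\<close>, then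
  return to the value \<open>s = 0\<close> that may have been excluded.\<close>

lemma poly_mult_zero_imp_zero:
  fixes \<psi> :: "complex \<Rightarrow> complex"
  assumes "continuous_on UNIV \<psi>" "p \<noteq> 0" "\<And>s. poly p s \<noteq> 0 \<Longrightarrow> \<psi> s = 0"
  shows "\<psi> s = 0"
proof -
  have "interior {s. poly p s = 0} = {}"
    using poly_roots_finite[OF assms(2)] by (rule empty_interior_finite)
  then have "closure (- {s. poly p s = 0}) = UNIV"
    by (simp add: closure_complement)
  moreover have "closure (- {s. poly p s = 0}) \<subseteq> {s \<in> UNIV. \<psi> s = 0}"
    by (intro closure_minimal continuous_closed_preimage_constant assms closed_UNIV) (auto intro: assms(3))
  ultimately show ?thesis by blast
qed

lemma det_mat_3: "det (mat c :: complex^3^3) = c ^ 3"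
  by (simp add: det_3 mat_def power3_eq_cube)

lemma mat_mult_3:
  "mat c ** A = (\<chi> i j. c * A $ i $ j)" "A ** mat c = (\<chi> i j. c * A $ i $ j)" for A :: "complex^3^3"
  by (simp_all add: matrix_matrix_mult_def mat_def vec_eq_iff sum_3 forall_3)

lemma cube_root_exists: obtains r :: complex where "r ^ 3 = z"
  using nth_root_exists[of 3 z] by auto

text \<open>The scalars \<open>1 / s\<close> and \<open>s\<close> with \<open>s ^ 3 = det Q\<close>
  move \<open>Q\<close> and \<open>P\<close> into \<open>SL\<close> and cancel each other. Thus the
  equality covers inhomogeneous \<open>f\<close>, such as the relation \<phi> of
  \<open>homogeneous_invariants_not_onto\<close>.\<close>

lemma eval_conj:
  fixes P Q :: "complex^3^3"
  assumes "f \<in> invariants" "Q ** P = mat 1"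
  shows "eval_poly f (\<chi> l. Q ** X $ l ** P) = eval_poly f X"
proof -
  have "det Q * det P = 1"
    by (metis assms(2) det_I det_mul)
  obtain s where s: "s ^ 3 = det Q" by (rule cube_root_exists)
  have q0: "det Q \<noteq> 0" using \<open>det Q * det P = 1\<close> by auto
  then have s0: "s \<noteq> 0" using s \<open>det Q * det P = 1\<close> by auto
  have "det (mat (1 / s) ** Q) = 1" "det (mat s ** P) = 1"
    using s s0 q0 \<open>det Q * det P = 1\<close> by (simp_all add: det_mul det_mat_3 power_one_over)
  moreover have "mat (1 / s) ** Q ** X $ l ** (mat s ** P) = Q ** X $ l ** P" for l
    using s0 unfolding mat_mult_3 by (simp add: matrix_matrix_mult_def vec_eq_iff sum_3 field_simps)
  ultimately show ?thesis
    using eval_act[OF assms(1), of "mat (1 / s) ** Q" "mat s ** P" X] by simp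
qed

text \<open>Here the normalizing scalars do not cancel; they multiply the value by a power of the
  nonzero number \<open>r * s\<close>, so only vanishing is preserved.\<close>

lemma eval_GL:
  fixes M N :: "complex^3^3"
  assumes "f \<in> invariants" "homogeneous d f" "invertible M" "invertible N"
  shows "eval_poly f (\<chi> l. M ** X $ l ** N) = 0 \<longleftrightarrow> eval_poly f X = 0"
proof -
  obtain r s where rs: "r ^ 3 = det M" "s ^ 3 = det N" by (metis cube_root_exists)
  have nz: "r \<noteq> 0" "s \<noteq> 0" using rs assms(3,4) by (auto simp: invertible_det_nz)
  let ?A = "mat (1 / r) ** M" and ?B = "mat (1 / s) ** N"
  have "det ?A = 1" "det ?B = 1"
    using nz rs by (simp_all add: det_mul det_mat_3 power_one_over flip: rs)
  then have "eval_poly f (\<chi> l. ?A ** X $ l ** ?B) = eval_poly f X"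
    by (rule eval_act[OF assms(1)])
  moreover have "(\<chi> l. M ** X $ l ** N) = (\<chi> l a b. (r * s) * (\<chi> l. ?A ** X $ l ** ?B) $ l $ a $ b)"
    using nz unfolding mat_mult_3 by (simp add: vec_eq_iff matrix_matrix_mult_def sum_3 field_simps)
  ultimately show ?thesis
    using eval_poly_scale[OF assms(2), of "r * s" "\<chi> l. ?A ** X $ l ** ?B"] nz by simp
qed

lemma singular_kernel:
  fixes A :: "complex^'n^'n"
  assumes "det A = 0"
  obtains v where "v \<noteq> 0" "A *v v = 0"
  using assms matrix_left_invertible_ker[of A] invertible_left_inverse[of A] invertible_det_nz[of A] by blast

lemma eigenvector_exists:
  fixes A :: "complex^3^3"
  obtains v e where "v \<noteq> 0" "A *v v = e *s v"
proof -
  \<comment> \<open>\<open>c1\<close> is the sum of the principal 2 x 2 minors, and \<open>p\<close>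
    is \<open>det (A - mat e)\<close> as a polynomial in \<open>e\<close>.\<close>
  define c1 where "c1 = A$1$1*A$2$2 - A$1$2*A$2$1 + A$1$1*A$3$3 - A$1$3*A$3$1 + A$2$2*A$3$3 - A$2$3*A$3$2"
  define p where "p = [:det A, - c1, A$1$1 + A$2$2 + A$3$3, -1:]"
  have "degree p > 0" by (simp add: p_def)
  then obtain e where "poly p e = 0" using alg_closed_imp_poly_has_root[of p] by auto
  moreover have "det (A - mat e) = poly p e"
    by (simp add: p_def c1_def det_3 mat_def) (simp add: algebra_simps)
  ultimately obtain v where "v \<noteq> 0" "(A - mat e) *v v = 0"
    using singular_kernel[of "A - mat e"] by auto
  moreover have "mat e *v v = e *s v"
    by (simp add: vec_eq_iff matrix_vector_mult_def mat_def sum_3 forall_3)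
  ultimately show ?thesis
    by (intro that[of v e]) (simp_all add: matrix_vector_mult_diff_rdistrib)
qed

text \<open>Conjugation writes \<open>Z\<close> in the basis of columns of \<open>P\<close>: if
  \<open>Z\<close> sends column \<open>j\<close> to \<open>c\<close> times column \<open>j'\<close>,
  the new column \<open>j\<close> is \<open>c\<close> times a unit vector.\<close>

lemma conj_column:
  fixes P Q Z :: "complex^'n::finite^'n"
  assumes "Q ** P = mat 1" "\<And>k. (Z ** P) $ k $ j = c * P $ k $ j'"
  shows "(Q ** Z ** P) $ i $ j = c * (mat 1 :: complex^'n^'n) $ i $ j'"
proof -
  have "(Q ** Z ** P) $ i $ j = (\<Sum>k\<in>UNIV. Q $ i $ k * (Z ** P) $ k $ j)"
    unfolding matrix_mul_assoc[symmetric] by (subst matrix_matrix_mult_def) simp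
  also have "\<dots> = c * (Q ** P) $ i $ j'"
    by (simp add: assms(2)) (simp add: matrix_matrix_mult_def sum_distrib_left mult_ac)
  finally show ?thesis by (simp add: assms(1))
qed

lemma basis_extension_3:
  fixes v :: "complex^3"
  assumes "v \<noteq> 0"
  obtains P :: "complex^3^3" where "invertible P" "\<forall>k. P $ k $ 1 = v $ k"
proof -
  consider "v $ 1 \<noteq> 0" | "v $ 2 \<noteq> 0" | "v $ 3 \<noteq> 0"
    using assms by (auto simp: vec_eq_iff forall_3)
  then show ?thesis
  proof cases
    case 1
    then show ?thesis
      by (intro that[of "vector [vector [v$1, 0, 0], vector [v$2, 1, 0], vector [v$3, 0, 1]]"])
        (simp_all add: invertible_det_nz det_3 forall_3)
  next
    case 2
    then show ?thesis
      by (intro that[of "vector [vector [v$1, 1, 0], vector [v$2, 0, 0], vector [v$3, 0, 1]]"])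
        (simp_all add: invertible_det_nz det_3 forall_3)
  next
    case 3
    then show ?thesis
      by (intro that[of "vector [vector [v$1, 1, 0], vector [v$2, 0, 1], vector [v$3, 0, 0]]"])
        (simp_all add: invertible_det_nz det_3 forall_3)
  qed
qed

text \<open>A slice that meets a dense set of orbits, cut out by 16 equations on the coordinates:
  multiply by the inverse of \<open>X l1\<close>, then conjugate to a basis \<open>v, Y v, Y\<^sup>2 v\<close> with
  \<open>Y = X l2\<close> and \<open>v\<close> an eigenvector of \<open>X l3\<close>.\<close>

definition slice :: "'m \<Rightarrow> 'm \<Rightarrow> 'm \<Rightarrow> (complex^3^3^'m::finite) set" where
  "slice l1 l2 l3 = {X. (\<exists>c. X $ l1 = mat c) \<and>
     (\<forall>a. X $ l2 $ a $ 1 = (if a = 2 then 1 else 0)) \<and>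
     (\<forall>a. X $ l2 $ a $ 2 = (if a = 3 then 1 else 0)) \<and>
     X $ l3 $ 2 $ 1 = 0 \<and> X $ l3 $ 3 $ 1 = 0}"

text \<open>The conditions of the slice are removed one at a time. An eigenvector of
  \<open>X $ l3\<close> always exists, so that step is exact; cyclicity of the vector and
  invertibility of \<open>X $ l1\<close> hold only generically, so those steps perturb one matrix
  along a line and return by continuity.\<close>

lemma slice_dense:
  fixes f :: "(3, 'm::finite) matpoly"
  assumes f: "f \<in> invariants"
    and l: "l1 \<noteq> l2" "l1 \<noteq> l3" "l2 \<noteq> l3"
    and slice: "\<And>X. X \<in> slice l1 l2 l3 \<Longrightarrow> eval_poly f X = 0"
  shows "eval_poly f X = 0"
proof -
  have mat1: "Q ** mat c ** P = mat c" if "Q ** P = mat 1" for Q P :: "complex^3^3" and c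
    by (metis mat_mult_3 matrix_mul_assoc matrix_mul_rid that)
  have 1: "eval_poly f X = 0"
    if X: "X $ l1 = mat c" "X $ l3 $ 2 $ 1 = 0" "X $ l3 $ 3 $ 1 = 0" for c and X :: "complex^3^3^'m"
  proof -
    \<comment> \<open>The shift \<open>e1 -> e2 -> e3\<close>, for which \<open>e1\<close> is
      cyclic: with \<open>Y + s * E\<close> in place of \<open>Y\<close>, the determinant with
      columns \<open>e1\<close>, \<open>Y e1\<close>, \<open>Y^2 e1\<close> has leading term
      \<open>s ^ 3\<close>, so \<open>p\<close> is nonzero. Only \<open>X $ l2\<close> moves, which
      keeps the conditions on \<open>l1\<close> and \<open>l3\<close>.\<close>
    define E :: "complex^3^3" where "E = vector [vector [0, 0, 0], vector [1, 0, 0], vector [0, 1, 0]]"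
    define X' where "X' s = (\<chi> l a b. if l = l2 then X $ l2 $ a $ b + s * E $ a $ b else X $ l $ a $ b)" for s
    define Y where "Y = X $ l2"
    let ?a = "Y $ 2 $ 1" and ?b = "Y $ 3 $ 2" and ?q = "Y $ 3 $ 1"
    let ?C = "Y$3$1 * Y$1$1 + Y$3$3 * Y$3$1"
    define p where "p = [:?a * ?C + ?a^2 * ?b - ?q * ?a * (Y$1$1 + Y$2$2) - ?q^2 * Y$2$3,
       ?C + ?a^2 + 2 * ?a * ?b - ?q * (Y$1$1 + Y$2$2), 2 * ?a + ?b, 1:]"
    have "eval_poly f (X' s) = 0" if "poly p s \<noteq> 0" for s
    proof -
      let ?Y = "X' s $ l2"
      define P :: "complex^3^3" where "P = (\<chi> i j. if j = 1 then mat 1 $ i $ 1 else if j = 2 then ?Y $ i $ 1 else (?Y ** ?Y) $ i $ 1)"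
      have "det P = poly p s"
        by (simp add: P_def det_3 p_def mat_def X'_def E_def Y_def matrix_matrix_mult_def sum_3)
          (simp add: algebra_simps power2_eq_square)
      then have "invertible P" using that by (simp add: invertible_det_nz)
      then obtain Q where Q: "Q ** P = mat 1" by (auto simp: invertible_def)
      define W where "W = (\<chi> l. Q ** X' s $ l ** P)"
      have c1: "(?Y ** P) $ k $ 1 = 1 * P $ k $ 2" and c2: "(?Y ** P) $ k $ 2 = 1 * P $ k $ 3" for k
        by (simp_all add: P_def matrix_matrix_mult_def sum_3 mat_def)
      have c3: "(X' s $ l3 ** P) $ k $ 1 = X $ l3 $ 1 $ 1 * P $ k $ 1" for k
        using X l exhaust_3[of k] by (auto simp: X'_def P_def matrix_matrix_mult_def sum_3 mat_def)
      have "X' s $ l1 = mat c"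
        using X l by (simp add: X'_def vec_eq_iff)
      then have "W $ l1 = mat c" using mat1[OF Q] by (simp add: W_def)
      moreover have "W $ l2 $ k $ 1 = 1 * (mat 1 :: complex^3^3) $ k $ 2"
        "W $ l2 $ k $ 2 = 1 * (mat 1 :: complex^3^3) $ k $ 3"
        "W $ l3 $ k $ 1 = X $ l3 $ 1 $ 1 * (mat 1 :: complex^3^3) $ k $ 1" for k
        unfolding W_def vec_lambda_beta
        by (rule conj_column[OF Q c1] conj_column[OF Q c2] conj_column[OF Q c3])+
      ultimately have "W \<in> slice l1 l2 l3"
        by (auto simp: slice_def mat_def)
      then have "eval_poly f W = 0" by (rule slice)
      then show ?thesis using eval_conj[OF f Q] by (simp add: W_def)
    qed
    moreover have "p \<noteq> 0" by (simp add: p_def)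
    moreover have "continuous_on UNIV (\<lambda>s. eval_poly f (X' s))"
      unfolding X'_def
      by (intro continuous_on_eval_poly continuous_on_vec_lambda, rename_tac l a b, case_tac "l = l2")
        (auto intro!: continuous_intros)
    ultimately have "eval_poly f (X' 0) = 0"
      by (intro poly_mult_zero_imp_zero[of "\<lambda>s. eval_poly f (X' s)" p 0])
    moreover have "X' 0 = X" by (simp add: X'_def vec_eq_iff)
    ultimately show ?thesis by simp
  qed
  have 2: "eval_poly f X = 0" if X: "X $ l1 = mat c" for c and X :: "complex^3^3^'m"
  proof -
    obtain v e where v: "v \<noteq> 0" "X $ l3 *v v = e *s v" by (rule eigenvector_exists)
    obtain P :: "complex^3^3" where P: "invertible P" "\<And>k. P $ k $ 1 = v $ k"
      using basis_extension_3[OF v(1)] by blast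
    then obtain Q where Q: "Q ** P = mat 1" by (auto simp: invertible_def)
    have c: "(X $ l3 ** P) $ k $ 1 = e * P $ k $ 1" for k
      using v(2) by (simp add: P(2) matrix_matrix_mult_def matrix_vector_mult_def vec_eq_iff)
    have "(Q ** X $ l3 ** P) $ i $ 1 = e * (mat 1 :: complex^3^3) $ i $ 1" for i
      by (rule conj_column[OF Q c])
    then have "eval_poly f (\<chi> l. Q ** X $ l ** P) = 0"
      by (intro 1[of _ c]) (simp_all add: X mat1[OF Q], simp_all add: mat_def)
    then show ?thesis using eval_conj[OF f Q] by simp
  qed
  define X' where "X' s = (\<chi> l a b. if l = l1 then X $ l1 $ a $ b + s * mat 1 $ a $ b else X $ l $ a $ b)" for s
  define A where "A = X $ l1"
  define c1 where "c1 = A$1$1*A$2$2 - A$1$2*A$2$1 + A$1$1*A$3$3 - A$1$3*A$3$1 + A$2$2*A$3$3 - A$2$3*A$3$2"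
  define p where "p = [:det A, c1, A$1$1 + A$2$2 + A$3$3, 1:]"
  have "eval_poly f (X' s) = 0" if "poly p s \<noteq> 0" for s
  proof -
    let ?A = "X' s $ l1"
    have "det ?A = poly p s"
      by (simp add: X'_def p_def c1_def det_3 mat_def A_def algebra_simps)
    then have inv: "invertible ?A" using that by (simp add: invertible_det_nz)
    obtain r where r: "r ^ 3 = det ?A" by (rule cube_root_exists)
    \<comment> \<open>The factor \<open>r\<close> restores determinant 1 and turns the matrix at
      \<open>l1\<close> into \<open>mat r\<close>; this is why the slice admits every scalar matrix
      there, not just the identity.\<close>
    have "det (mat r ** matrix_inv ?A) = 1"
      using det_matrix_inv[OF inv] r by (simp add: det_mul det_mat_3)
    then have "eval_poly f (\<chi> l. mat r ** matrix_inv ?A ** X' s $ l ** mat 1) = eval_poly f (X' s)"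
      by (intro eval_act f) simp_all
    moreover have "eval_poly f (\<chi> l. mat r ** matrix_inv ?A ** X' s $ l ** mat 1) = 0"
      by (rule 2[of _ r]) (simp add: matrix_inv_inverse[OF inv] flip: matrix_mul_assoc)
    ultimately show ?thesis by simp
  qed
  moreover have "p \<noteq> 0" by (simp add: p_def)
  moreover have "continuous_on UNIV (\<lambda>s. eval_poly f (X' s))"
    unfolding X'_def
    by (intro continuous_on_eval_poly continuous_on_vec_lambda, rename_tac l a b, case_tac "l = l1")
        (auto intro!: continuous_intros)
  ultimately have "eval_poly f (X' 0) = 0"
    by (intro poly_mult_zero_imp_zero[of "\<lambda>s. eval_poly f (X' s)" p 0])
  moreover have "X' 0 = X" by (simp add: X'_def vec_eq_iff)
  ultimately show ?thesis by simp
qed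

subsection \<open>Reducing the number of cubic invariants\<close>

lemma slice_coordinates:
  fixes l1 l2 l3 :: "'m::finite"
  assumes l: "l1 \<noteq> l2" "l1 \<noteq> l3" "l2 \<noteq> l3"
  obtains J :: "('m \<times> 3 \<times> 3) set" where "card J = 9 * CARD('m) - 16"
    "\<And>l a b. poly_on (slice l1 l2 l3) J (\<lambda>X (l, a, b). X $ l $ a $ b) 1 (\<lambda>X. X $ l $ a $ b)"
proof -
  let ?y = "\<lambda>(X :: complex^3^3^'m) (l, a, b). X $ l $ a $ b"
  let ?S = "slice l1 l2 l3"
  \<comment> \<open>The 16 equations: 8 make \<open>X $ l1\<close> scalar, 6 fix the first two
    columns of \<open>X $ l2\<close>, and 2 concern the first column of \<open>X $ l3\<close>. The
    entry \<open>(l1, 1, 1)\<close> remains as the free scalar.\<close>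
  define C :: "('m \<times> 3 \<times> 3) set" where
    "C = {l1} \<times> (UNIV - {(1, 1)}) \<union> {l2} \<times> UNIV \<times> {1, 2} \<union> {l3} \<times> {2, 3} \<times> {1}"
  define J where "J = - C"
  have "card C = card ({l1} \<times> ((UNIV :: (3 \<times> 3) set) - {(1, 1)})) + card ({l2} \<times> (UNIV :: 3 set) \<times> {1, 2 :: 3})
      + card ({l3} \<times> {2, 3 :: 3} \<times> {1 :: 3})"
    unfolding C_def using l by (subst card_Un_disjoint; (subst card_Un_disjoint)?) auto
  also have "\<dots> = 16"
    by (simp add: card_cartesian_product card_Diff_singleton)
  finally have "card J = 9 * CARD('m) - 16"
    by (simp add: J_def Compl_eq_Diff_UNIV card_Diff_subset)
  moreover have "poly_on ?S J ?y 1 (\<lambda>X. X $ l $ a $ b)" for l a b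
  proof (cases "(l, a, b) \<in> J")
    case True
    then show ?thesis
      using poly_on_coordinate[of J "(l, a, b)" ?S ?y] by simp
  next
    case False
    then consider "l = l1" "a \<noteq> b" | "l = l1" "a = b" | "l = l2" "b = 1 \<or> b = 2" | "l = l3" "a \<noteq> 1" "b = 1"
      by (auto simp: J_def C_def)
    then show ?thesis
    proof cases
      case 1
      then have "X $ l $ a $ b = 0" if "X \<in> ?S" for X
        using that by (auto simp: slice_def mat_def)
      then show ?thesis
        by (simp add: poly_on_0 cong: poly_on_cong)
    next
      case 2
      have "(l1, 1, 1) \<in> J" using l by (auto simp: J_def C_def)
      then have "poly_on ?S J ?y 1 (\<lambda>X. X $ l1 $ 1 $ 1)"
        using poly_on_coordinate[of J "(l1, 1, 1)" ?S ?y] by simp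
      moreover have "X $ l $ a $ b = X $ l1 $ 1 $ 1" if "X \<in> ?S" for X
        using 2 that by (auto simp: slice_def mat_def)
      ultimately show ?thesis
        by (simp cong: poly_on_cong)
    next
      case 3
      then have "X $ l $ a $ b = (if b = 1 \<and> a = 2 \<or> b = 2 \<and> a = 3 then 1 else 0)" if "X \<in> ?S" for X
        using that by (auto simp: slice_def)
      then show ?thesis
        by (simp add: poly_on_const cong: poly_on_cong)
    next
      case 4
      then have "X $ l $ a $ b = 0" if "X \<in> ?S" for X
        using that exhaust_3[of a] by (auto simp: slice_def)
      then show ?thesis
        by (simp add: poly_on_0 cong: poly_on_cong)
    qed
  qed
  ultimately show ?thesis using that by blast
qed

text \<open>With the relation of \<open>algebraic_relation\<close>, the points \<open>(t, t^K, t^(K^2), \<dots>)\<close> cannot all be values.\<close>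

lemma homogeneous_invariants_not_onto:
  fixes f :: "nat \<Rightarrow> (3, 'm::finite) matpoly"
  assumes f: "\<And>i. i < n \<Longrightarrow> f i \<in> invariants_of_degree d" and d: "d > 0"
    and m: "CARD('m) \<ge> 3" and n: "n > 9 * CARD('m) - 16"
  obtains a where "\<And>i. i < n \<Longrightarrow> a i \<noteq> 0" "\<nexists>X. \<forall>i<n. eval_poly (f i) X = a i"
proof -
  obtain L :: "'m set" where "card L = 3"
    by (rule obtain_subset_with_card_n[OF m])
  then obtain l1 l2 l3 :: 'm where l: "l1 \<noteq> l2" "l1 \<noteq> l3" "l2 \<noteq> l3"
    by (auto simp: card_3_iff)
  obtain J :: "('m \<times> 3 \<times> 3) set" where J: "card J = 9 * CARD('m) - 16"
    "\<And>l a b. poly_on (slice l1 l2 l3) J (\<lambda>X (l, a, b). X $ l $ a $ b) 1 (\<lambda>X. X $ l $ a $ b)"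
    using slice_coordinates[OF l] by blast
  have pol: "poly_on (slice l1 l2 l3) J (\<lambda>X (l, a, b). X $ l $ a $ b) d (eval_poly (f i))" if "i < n" for i
  proof (rule poly_on_eval_poly)
    show "homogeneous d (f i)"
      using f[OF that] by (simp add: invariants_of_degree_def)
  qed (rule finite_class.finite J(2))+
  have "card J < n" using J(1) n by (rule ord_eq_less_trans)
  obtain K u where K: "K > 0" and u: "\<exists>j<K ^ n. u j \<noteq> 0" and
    rel: "\<And>X. X \<in> slice l1 l2 l3 \<Longrightarrow> (\<Sum>j<K ^ n. u j * (\<Prod>i<n. eval_poly (f i) X ^ (j div K ^ i mod K))) = 0"
    proof (rule algebraic_relation[where f = "\<lambda>i. eval_poly (f i)" and n = n, OF finite_class.finite pol \<open>card J < n\<close>])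
      fix i assume "i < n"
      then show "i < n" .
    qed (rule that)
  \<comment> \<open>On the slice this is the relation just found; being an invariant, it vanishes
    everywhere by \<open>slice_dense\<close>.\<close>
  define \<phi> where "\<phi> = (\<Sum>j<K ^ n. Poly_Mapping.single 0 (u j) * (\<Prod>i<n. f i ^ (j div K ^ i mod K)))"
  have eval: "eval_poly \<phi> X = (\<Sum>j<K ^ n. u j * (\<Prod>i<n. eval_poly (f i) X ^ (j div K ^ i mod K)))" for X
    by (simp add: \<phi>_def eval_poly_sum eval_poly_smult eval_poly_prod eval_poly_power)
  have "\<phi> \<in> invariants"
    unfolding \<phi>_def
    by (intro invariants_sum invariants_smult invariants_prod invariants_power)
      (use f in \<open>simp add: invariants_of_degree_def\<close>)
  then have zero: "eval_poly \<phi> X = 0" for X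
    by (rule slice_dense[OF _ l]) (simp add: eval rel)
  \<comment> \<open>Kronecker substitution of \<open>t ^ (K ^ i)\<close> for the \<open>i\<close>-th
    value: the base \<open>K\<close> digits reassemble to \<open>j\<close>, so distinct terms stay
    distinct and \<open>p\<close> is nonzero.\<close>
  define p where "p = (\<Sum>j<K ^ n. Polynomial.monom (u j) j)"
  obtain j where j: "j < K ^ n" "u j \<noteq> 0" using u by blast
  have "coeff p j = u j"
    using j by (simp add: p_def coeff_sum)
  then have "p \<noteq> 0" using j by auto
  then obtain t where t: "poly p t \<noteq> 0"
    using poly_all_0_iff_0[of p] by auto
  have no: "\<nexists>X. \<forall>i<n. eval_poly (f i) X = t ^ (K ^ i)"
  proof
    assume "\<exists>X. \<forall>i<n. eval_poly (f i) X = t ^ (K ^ i)"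
    then obtain X where X: "\<And>i. i < n \<Longrightarrow> eval_poly (f i) X = t ^ (K ^ i)" by blast
    have "(\<Prod>i<n. eval_poly (f i) X ^ (j div K ^ i mod K)) = t ^ j" if "j < K ^ n" for j
    proof -
      have "(\<Prod>i<n. eval_poly (f i) X ^ (j div K ^ i mod K)) = (\<Prod>i<n. t ^ ((j div K ^ i mod K) * K ^ i))"
        by (intro prod.cong) (auto simp: X mult.commute simp flip: power_mult)
      also have "\<dots> = t ^ j"
        using that by (simp add: sum_digits flip: power_sum)
      finally show ?thesis .
    qed
    then have "eval_poly \<phi> X = poly p t"
      by (simp add: eval p_def poly_sum poly_monom)
    then show False using t zero by simp
  qed
  \<comment> \<open>For \<open>t = 0\<close> the point would be the origin, which is the value at
    the zero tuple.\<close>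
  have "t \<noteq> 0"
  proof
    assume "t = 0"
    have "eval_poly (f i) 0 = 0" if "i < n" for i
      by (rule eval_poly_at_0[OF _ d]) (use f[OF that] in \<open>simp add: invariants_of_degree_def\<close>)
    then have "\<forall>i<n. eval_poly (f i) 0 = t ^ (K ^ i)"
      using K by (simp add: \<open>t = 0\<close>)
    then show False using no by blast
  qed
  then show ?thesis
    by (intro that[of "\<lambda>i. t ^ (K ^ i)"] no) simp
qed

lemma defining_set_reduction:
  fixes F :: "(3, 'm::finite) matpoly set"
  assumes "finite F" "F \<subseteq> invariants_of_degree 3" "CARD('m) \<ge> 3"
  obtains F' where "finite F'" "F' \<subseteq> invariants_of_degree 3" "card F' \<le> 9 * CARD('m) - 16"
    "zero_set F' = zero_set F"
  using assms(1,2)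
proof (induction "card F" arbitrary: F thesis rule: less_induct)
  case less
  define n where "n = card F"
  show ?case
  proof (cases "n \<le> 9 * CARD('m) - 16")
    case True
    then show ?thesis using less.prems by (simp add: n_def)
  next
    case False
    obtain f where f: "bij_betw f {..<n} F"
      using ex_bij_betw_nat_finite[OF less.prems(2)] by (auto simp: n_def atLeast0LessThan)
    then have F: "F = f ` {..<n}" by (simp add: bij_betw_def)
    then have inv: "f i \<in> invariants_of_degree 3" if "i < n" for i
      using that less.prems(3) by blast
    obtain a where a: "\<And>i. i < n \<Longrightarrow> a i \<noteq> 0" "\<nexists>X. \<forall>i<n. eval_poly (f i) X = a i"
      using homogeneous_invariants_not_onto[of n f 3] inv False assms(3) by (metis not_le zero_less_numeral)
    have n: "n > 0" using False by simp
    \<comment> \<open>Linear projection along the line through \<open>a\<close>. The form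
      \<open>g 0\<close> is zero, so the indices from 1 to \<open>n - 1\<close> remain.\<close>
    define g where "g i = f i + Poly_Mapping.single 0 (- a i / a 0) * f 0" for i
    have eval_g: "eval_poly (g i) X = eval_poly (f i) X - a i / a 0 * eval_poly (f 0) X" for i X
      by (simp only: g_def eval_poly_add eval_poly_smult) simp
    have "card (g ` {1..<n}) \<le> n - 1"
      using card_image_le[of "{1..<n}" g] by simp
    moreover have "g ` {1..<n} \<subseteq> invariants_of_degree 3"
      using inv n unfolding g_def image_subset_iff
      by (intro ballI invariants_of_degree_lincomb) simp_all
    moreover have "zero_set (g ` {1..<n}) = zero_set F"
    proof (intro equalityI subsetI)
      fix X assume "X \<in> zero_set (g ` {1..<n})"
      then have X: "eval_poly (f i) X = eval_poly (f 0) X / a 0 * a i" if "i < n" for i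
        using that a(1)[OF n] eval_g[of i X] by (cases "i = 0") (auto simp: zero_set_def)
      have "eval_poly (f 0) X = 0"
      proof (rule ccontr)
        assume nz: "eval_poly (f 0) X \<noteq> 0"
        \<comment> \<open>All \<open>f i\<close> are cubic, so scaling the tuple by \<open>r\<close>
          multiplies every value by \<open>r ^ 3\<close>; the multiple of \<open>a\<close> attained
          at \<open>X\<close> becomes \<open>a\<close> itself.\<close>
        obtain r where r: "r ^ 3 = a 0 / eval_poly (f 0) X" by (rule cube_root_exists)
        have "eval_poly (f i) (\<chi> l b c. r * X $ l $ b $ c) = a i" if "i < n" for i
        proof -
          have "eval_poly (f i) (\<chi> l b c. r * X $ l $ b $ c) = r ^ 3 * eval_poly (f i) X"
            using inv[OF that] by (intro eval_poly_scale) (simp add: invariants_of_degree_def)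
          also have "\<dots> = a i"
            using nz a(1)[OF n] by (simp add: X[OF that] r)
          finally show ?thesis .
        qed
        then show False using a(2) by blast
      qed
      then show "X \<in> zero_set F"
        using X by (auto simp: zero_set_def F)
    next
      fix X assume "X \<in> zero_set F"
      then show "X \<in> zero_set (g ` {1..<n})"
        using n by (auto simp: zero_set_def F eval_g)
    qed
    ultimately show ?thesis
      using less.hyps[of "g ` {1..<n}"] less.prems(1) n
      by (metis (no_types, lifting) One_nat_def diff_less finite_atLeastLessThan finite_imageI le_less_trans lessI n_def)
  qed
qed

subsection \<open>Spaces of singular matrices of size 3\<close>

text \<open>Closure under \<open>A + c * B\<close> also gives multiples, since
  \<open>c * A = A + (c - 1) * A\<close>.\<close>

definition mat_space :: "(complex^3^3) set \<Rightarrow> bool" where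
  "mat_space L \<longleftrightarrow> (\<forall>A\<in>L. \<forall>B\<in>L. \<forall>c. (\<chi> i j. A $ i $ j + c * B $ i $ j) \<in> L)"

definition singular_space :: "(complex^3^3) set \<Rightarrow> bool" where
  "singular_space L \<longleftrightarrow> mat_space L \<and> (\<forall>A\<in>L. det A = 0)"

definition skew :: "complex^3^3 \<Rightarrow> bool" where
  "skew A \<longleftrightarrow> (\<forall>i j. A $ i $ j = - A $ j $ i)"

text \<open>The first three cases are the normal forms of the compression spaces.\<close>

definition tame :: "(complex^3^3) set \<Rightarrow> bool" where
  "tame L \<longleftrightarrow> (\<forall>A\<in>L. \<forall>i. A $ i $ 3 = 0) \<or> (\<forall>A\<in>L. \<forall>j. A $ 3 $ j = 0) \<or>
     (\<forall>A\<in>L. \<forall>i. \<forall>j. i \<noteq> 1 \<longrightarrow> j \<noteq> 1 \<longrightarrow> A $ i $ j = 0) \<or> (\<forall>A\<in>L. skew A)"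

definition equiv_tame :: "(complex^3^3) set \<Rightarrow> bool" where
  "equiv_tame L \<longleftrightarrow> (\<exists>M N. invertible M \<and> invertible N \<and> tame ((\<lambda>A. M ** A ** N) ` L))"

definition equivalent :: "complex^3^3 \<Rightarrow> complex^3^3 \<Rightarrow> bool" where
  "equivalent A B \<longleftrightarrow> (\<exists>M N. invertible M \<and> invertible N \<and> M ** A ** N = B)"

abbreviation mat3 :: "complex \<Rightarrow> complex \<Rightarrow> complex \<Rightarrow> complex \<Rightarrow> complex \<Rightarrow> complex \<Rightarrow> complex \<Rightarrow> complex \<Rightarrow> complex \<Rightarrow> complex^3^3" where
  "mat3 a b c d e f g h i \<equiv> vector [vector [a, b, c], vector [d, e, f], vector [g, h, i]]"

abbreviation "E2 \<equiv> mat3 1 0 0 0 1 0 0 0 0"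
abbreviation "E1 \<equiv> mat3 1 0 0 0 0 0 0 0 0"

lemma mult_assoc_5: "M ** (M' ** A ** N') ** N = (M ** M') ** A ** (N' ** N)" for A :: "complex^3^3"
  by (simp add: matrix_mul_assoc)

lemma invertible_mat_1: "invertible (mat 1 :: complex^3^3)"
  by (simp add: invertible_det_nz)

lemma equiv_tame_image:
  assumes "equiv_tame ((\<lambda>A. M ** A ** N) ` L)" "invertible M" "invertible N"
  shows "equiv_tame L"
proof -
  obtain M' N' where MN: "invertible M'" "invertible N'" "tame ((\<lambda>A. M' ** A ** N') ` (\<lambda>A. M ** A ** N) ` L)"
    using assms(1) unfolding equiv_tame_def by blast
  have "(\<lambda>A. M' ** A ** N') ` (\<lambda>A. M ** A ** N) ` L = (\<lambda>A. (M' ** M) ** A ** (N ** N')) ` L"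
    by (simp add: image_image mult_assoc_5)
  then show ?thesis
    unfolding equiv_tame_def using MN assms(2,3) by (metis invertible_mult)
qed

lemma equiv_tame_block:
  fixes M N :: "complex^3^3"
  assumes "invertible M" "invertible N"
    and "\<And>A i j. A \<in> L \<Longrightarrow> i \<noteq> 1 \<Longrightarrow> j \<noteq> 1 \<Longrightarrow> (M ** A ** N) $ i $ j = 0"
  shows "equiv_tame L"
proof -
  have "tame ((\<lambda>A. M ** A ** N) ` L)"
    using assms(3) by (simp add: tame_def)
  then show ?thesis using assms(1,2) unfolding equiv_tame_def by blast
qed

lemma equiv_tame_skew:
  fixes M N :: "complex^3^3"
  assumes "invertible M" "invertible N" "\<And>A. A \<in> L \<Longrightarrow> skew (M ** A ** N)"
  shows "equiv_tame L"
proof -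
  have "tame ((\<lambda>A. M ** A ** N) ` L)"
    using assms(3) by (simp add: tame_def)
  then show ?thesis using assms(1,2) unfolding equiv_tame_def by blast
qed

lemma tame_equiv_tame: "tame L \<Longrightarrow> equiv_tame L"
  unfolding equiv_tame_def by (intro exI[of _ "mat 1"]) (simp add: invertible_det_nz)

lemma equivalent_trans: "equivalent (M ** A ** N) B \<Longrightarrow> invertible M \<Longrightarrow> invertible N \<Longrightarrow> equivalent A B"
  unfolding equivalent_def by (metis mult_assoc_5 invertible_mult)

lemma singular_space_image:
  assumes "singular_space L"
  shows "singular_space ((\<lambda>A. M ** A ** N) ` L)"
proof -
  have "(\<chi> i j. (M ** A ** N) $ i $ j + c * (M ** B ** N) $ i $ j) = M ** (\<chi> i j. A $ i $ j + c * B $ i $ j) ** N"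
    for A B :: "complex^3^3" and c
    by (simp add: vec_eq_iff matrix_matrix_mult_def sum_3) (simp add: algebra_simps)
  then show ?thesis
    using assms unfolding singular_space_def mat_space_def by (auto simp: det_mul)
qed

lemma mat_spaceD: "mat_space L \<Longrightarrow> A \<in> L \<Longrightarrow> B \<in> L \<Longrightarrow> (\<chi> i j. A $ i $ j + c * B $ i $ j) \<in> L"
  by (simp add: mat_space_def)

text \<open>The coefficients of \<open>t\<^sup>2\<close>, \<open>t\<close> and \<open>1\<close> in \<open>det (C + t E2)\<close>.\<close>

lemma singular_space_E2:
  assumes L: "singular_space L" "E2 \<in> L" and C: "C \<in> L"
  shows "C$3$3 = 0" "C$3$1 * C$1$3 + C$3$2 * C$2$3 = 0"
    "C$3$1 * (C$2$2 * C$1$3 - C$1$2 * C$2$3) + C$3$2 * (C$1$1 * C$2$3 - C$2$1 * C$1$3) = 0"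
proof -
  have d: "det (\<chi> i j. C $ i $ j + t * E2 $ i $ j) = 0" for t
    using L C mat_spaceD unfolding singular_space_def by blast
  note d = d[unfolded det_3, simplified]
  show 1: "C$3$3 = 0"
    using d[of 0] d[of 1] d[of "-1"] by simp algebra
  show "C$3$1 * C$1$3 + C$3$2 * C$2$3 = 0"
    using d[of 0] d[of 1] unfolding 1 by simp algebra
  show "C$3$1 * (C$2$2 * C$1$3 - C$1$2 * C$2$3) + C$3$2 * (C$1$1 * C$2$3 - C$2$1 * C$1$3) = 0"
    using d[of 0] unfolding 1 by simp algebra
qed

text \<open>By \<open>singular_space_E2\<close> the third row and third column of an element pair to
  0; polarizing this against \<open>B\<close> gives \<open>C$2$3 = - C$3$1\<close>. If
  \<open>C$3$1\<close> is always 0, rows 2, 3 and columns 1, 3 form a zero block. Otherwise a second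
  reference element \<open>C\<close> confines \<open>L\<close> to the span of \<open>E2\<close>,
  \<open>B'\<close> and \<open>C\<close>, which row operations make skew-symmetric.\<close>

lemma singular_space_normalized:
  assumes L: "singular_space L" "E2 \<in> L"
    and B: "B \<in> L" "B$1$3 = 1" "B$2$3 = 0" "B$3$1 = 0" "B$3$2 = 1"
  shows "equiv_tame L"
proof -
  have sp: "mat_space L" using L by (simp add: singular_space_def)
  note E = singular_space_E2[OF L]
  have B33: "B$3$3 = 0" and B21: "B$2$1 = 0" using E[OF B(1)] B by auto
  have c: "C$3$3 = 0" "C$2$3 = - C$3$1" if "C \<in> L" for C
    using E[OF mat_spaceD[OF sp that B(1), of 1]] E[OF that] E[OF B(1)] B
    by (simp_all add: eq_neg_iff_add_eq_0) algebra
  show ?thesis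
  proof (cases "\<forall>C\<in>L. C$3$1 = 0")
    case True
    have C21: "C$2$1 = 0" if C: "C \<in> L" for C
    proof -
      have "C$3$1 = 0" "C$2$3 = 0" using True c C by auto
      then have "(C$3$2 + s) * (C$2$1 * (C$1$3 + s)) = 0" for s
        using E(3)[OF mat_spaceD[OF sp C B(1), of s]] B B21 by simp
      from this[of 0] this[of 1] this[of "-1"] show ?thesis
        by simp algebra
    qed
    \<comment> \<open>Swapping columns 1 and 2 moves the zero block from rows 2, 3 and columns 1, 3
      to the place that \<open>tame\<close> expects.\<close>
    show ?thesis
    proof (rule equiv_tame_block)
      show "invertible (mat 1 :: complex^3^3)" "invertible (mat3 0 1 0 1 0 0 0 0 1)"
        by (rule invertible_mat_1 | simp add: invertible_det_nz det_3)+
    next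
      fix A and i j :: 3 assume A: "A \<in> L" and ij: "i \<noteq> 1" "j \<noteq> 1"
      have z: "A$3$1 = 0" "A$2$1 = 0" "A$2$3 = 0" "A$3$3 = 0"
        using c[OF A] C21[OF A] True A by simp_all
      have "i = 2 \<or> i = 3" "j = 2 \<or> j = 3"
        using ij exhaust_3[of i] exhaust_3[of j] by auto
      then show "(mat 1 ** A ** mat3 0 1 0 1 0 0 0 0 1) $ i $ j = 0"
        unfolding matrix_mul_lid by (elim disjE) (simp_all add: matrix_matrix_mult_def sum_3 z)
    qed
  next
    case False
    then obtain C0 where C0: "C0 \<in> L" "C0$3$1 \<noteq> 0" by blast
    define C1 where "C1 = (\<chi> i j. C0$i$j + (1 / C0$3$1 - 1) * C0$i$j)"
    have "C1 \<in> L" unfolding C1_def by (rule mat_spaceD[OF sp C0(1) C0(1)])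
    moreover have "C1$3$1 = 1" using C0(2) by (simp add: C1_def left_diff_distrib)
    ultimately have C1: "C1 \<in> L" "C1$3$1 = 1" by blast+
    define C2 where "C2 = (\<chi> i j. C1$i$j + (- C1$3$2) * B$i$j)"
    have "C2 \<in> L" unfolding C2_def by (rule mat_spaceD[OF sp C1(1) B(1)])
    moreover have "C2$3$1 = 1" "C2$3$2 = 0" using C1(2) B(4,5) by (simp_all add: C2_def)
    ultimately have C2: "C2 \<in> L" "C2$3$1 = 1" "C2$3$2 = 0" by blast+
    define C where "C = (\<chi> i j. C2$i$j + (- C2$2$2) * E2$i$j)"
    have "C \<in> L" unfolding C_def by (rule mat_spaceD[OF sp C2(1) L(2)])
    moreover have "C$3$1 = 1" "C$3$2 = 0" "C$2$2 = 0" using C2(2,3) by (simp_all add: C_def)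
    ultimately have C: "C \<in> L" "C$3$1 = 1" "C$3$2 = 0" "C$2$2 = 0" by blast+
    have C': "C$3$3 = 0" "C$2$3 = - 1" "C$1$3 = 0" "C$1$2 = 0"
      using c[OF C(1)] E[OF C(1)] C by auto
    define B' where "B' = (\<chi> i j. B$i$j + (- B$2$2) * E2$i$j)"
    have "B' \<in> L" unfolding B'_def by (rule mat_spaceD[OF sp B(1) L(2)])
    moreover have "B'$1$3 = 1" "B'$2$3 = 0" "B'$3$1 = 0" "B'$3$2 = 1" "B'$2$2 = 0" "B'$2$1 = 0" "B'$3$3 = 0"
      using B(2-5) B21 B33 by (simp_all add: B'_def)
    ultimately have B': "B' \<in> L" "B'$1$3 = 1" "B'$2$3 = 0" "B'$3$1 = 0" "B'$3$2 = 1" "B'$2$2 = 0" "B'$2$1 = 0" "B'$3$3 = 0"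
      by blast+
    define a b where "a = B'$1$1" and "b = B'$1$2"
    have ab: "C$1$1 = b" "C$2$1 = - a"
      using E(3)[OF mat_spaceD[OF sp B'(1) C(1), of 1]] E(3)[OF mat_spaceD[OF sp B'(1) C(1), of "-1"]] B' C C'
      by (simp_all add: a_def b_def) algebra+
    have D: "D$1$3 = D$3$2" "D$2$3 = - D$3$1" "D$3$3 = 0" "D$1$1 = D$2$2 + D$3$2 * a + D$3$1 * b"
      "D$2$1 = - a * D$3$1" "D$1$2 = b * D$3$2" if "D \<in> L" for D
    proof -
      show 1: "D$2$3 = - D$3$1" "D$3$3 = 0" using c that by auto
      show 2: "D$1$3 = D$3$2"
        using E(2)[OF mat_spaceD[OF sp that C(1), of 1]] E(2)[OF that] 1 C C' by simp algebra
      \<comment> \<open>Subtracting the combination of \<open>B'\<close> and \<open>C\<close> with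
        the same third row as \<open>D\<close> leaves a matrix supported in the upper left 2 x 2
        block; testing it with \<open>B'\<close>, \<open>C\<close> and their sum added shows that
        this block is scalar.\<close>
      define D' where "D' = (\<chi> i j. D$i$j + (- D$3$2) * B'$i$j)"
      define D2 where "D2 = (\<chi> i j. D'$i$j + (- D$3$1) * C$i$j)"
      have "D' \<in> L" unfolding D'_def by (intro mat_spaceD[OF sp] that B')
      then have D2: "D2 \<in> L" unfolding D2_def by (intro mat_spaceD[OF sp] C)
      have e: "D2$1$3 = 0" "D2$2$3 = 0" "D2$3$1 = 0" "D2$3$2 = 0" "D2$3$3 = 0"
        "D2$1$1 = D$1$1 - D$3$2 * a - D$3$1 * b" "D2$2$2 = D$2$2" "D2$2$1 = D$2$1 + D$3$1 * a"
        "D2$1$2 = D$1$2 - D$3$2 * b"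
        unfolding D2_def D'_def using 1 2 B' C C' ab by (simp_all add: a_def b_def)
      note X = mat_spaceD[OF sp D2 B'(1), of 1] and Y = mat_spaceD[OF sp D2 C(1), of 1]
      have "D2$2$1 = 0"
        using E(3)[OF X] e B' by simp algebra
      moreover have "D2$1$2 = 0"
        using E(3)[OF Y] e C C' by simp
      moreover have "D2$1$1 = D2$2$2"
        using E(3)[OF mat_spaceD[OF sp X C(1), of 1]] e B' C C' ab calculation
        by (simp add: a_def b_def) algebra
      ultimately show "D$1$1 = D$2$2 + D$3$2 * a + D$3$1 * b"
        "D$2$1 = - a * D$3$1" "D$1$2 = b * D$3$2"
        unfolding e by algebra+
    qed
    \<comment> \<open>Multiples of the third row remove \<open>a\<close> and \<open>b\<close>;
      exchanging the first two rows, with suitable signs, then makes \<open>E2\<close>,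
      \<open>B'\<close> and \<open>C\<close> skew at once.\<close>
    let ?M = "mat3 0 (-1) (-a) 1 0 (-b) 0 0 (-1)"
    show ?thesis
    proof (rule equiv_tame_skew)
      show "invertible ?M"
        by (simp add: invertible_det_nz det_3)
      show "skew (?M ** D ** mat 1)" if "D \<in> L" for D
        using D[OF that] unfolding skew_def matrix_mul_rid
        by (simp add: matrix_matrix_mult_def sum_3 forall_3)
    qed (rule invertible_mat_1)
  qed
qed

text \<open>The first two coordinates are changed by a matrix of determinant 1 and its inverse,
  which fixes \<open>E2\<close>. The new basis is the upper part \<open>q\<close> of the third
  column of \<open>C\<close> and a complement \<open>p\<close>. The row
  \<open>(C$3$1, C$3$2)\<close> annihilates \<open>q\<close>, so it is nonzero on \<open>p\<close>
  and can be scaled to \<open>(0, 1)\<close>.\<close>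

lemma singular_space_change_basis:
  assumes L: "singular_space L" "E2 \<in> L"
    and C: "C \<in> L" "C$1$3 \<noteq> 0 \<or> C$2$3 \<noteq> 0" "C$3$1 \<noteq> 0 \<or> C$3$2 \<noteq> 0"
  shows "equiv_tame L"
proof -
  define q1 q2 where "q1 = C$1$3" and "q2 = C$2$3"
  obtain p1 p2 where p: "q1 * p2 - q2 * p1 = 1"
  proof (cases "q1 = 0")
    case True
    then have "q2 \<noteq> 0" using C(2) by (simp add: q1_def q2_def)
    then show ?thesis using True that[of 0 "- 1 / q2"] by simp
  next
    case False
    then show ?thesis using that[of "1 / q1" 0] by simp
  qed
  define r where "r = C$3$1 * p1 + C$3$2 * p2"
  have rq: "C$3$1 * q1 + C$3$2 * q2 = 0"
    using singular_space_E2(2)[OF L C(1)] by (simp add: q1_def q2_def)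
  have r0: "r \<noteq> 0"
  proof
    assume "r = 0"
    have "C$3$1 * (q1 * p2 - q2 * p1) = p2 * (C$3$1 * q1 + C$3$2 * q2) - q2 * r"
      "C$3$2 * (q1 * p2 - q2 * p1) = q1 * r - p1 * (C$3$1 * q1 + C$3$2 * q2)"
      by (simp_all add: r_def algebra_simps)
    then have "C$3$1 = 0" "C$3$2 = 0"
      unfolding p rq \<open>r = 0\<close> by simp_all
    then show False using C(3) by simp
  qed
  define M N where "M = mat3 p2 (- p1) 0 (- q2) q1 0 0 0 (1 / r)" and "N = mat3 q1 p1 0 q2 p2 0 0 0 1"
  have "det M = (q1 * p2 - q2 * p1) / r" "det N = q1 * p2 - q2 * p1"
    by (simp_all add: M_def N_def det_3 diff_divide_distrib mult.commute)
  then have inv: "invertible M" "invertible N"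
    unfolding p invertible_det_nz using r0 by simp_all
  have p': "p2 * q1 - p1 * q2 = 1" "q1 * p2 - p1 * q2 = 1" "p2 * q1 - q2 * p1 = 1"
    using p by (simp_all only: mult.commute)
  have "M ** E2 ** N = E2"
    unfolding M_def N_def vec_eq_iff forall_3
    by (simp add: matrix_matrix_mult_def sum_3 p p')
  moreover have "M ** E2 ** N \<in> (\<lambda>A. M ** A ** N) ` L"
    using L(2) by (rule imageI)
  ultimately have "E2 \<in> (\<lambda>A. M ** A ** N) ` L"
    by (simp only:)
  moreover have "M ** C ** N \<in> (\<lambda>A. M ** A ** N) ` L"
    using C(1) by (rule imageI)
  moreover have "(M ** C ** N)$1$3 = p2 * q1 - p1 * q2" "(M ** C ** N)$2$3 = - q2 * q1 + q1 * q2"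
    "(M ** C ** N)$3$1 = (C$3$1 * q1 + C$3$2 * q2) / r" "(M ** C ** N)$3$2 = (C$3$1 * p1 + C$3$2 * p2) / r"
    by (simp_all add: M_def N_def matrix_matrix_mult_def sum_3 q1_def q2_def add_divide_distrib algebra_simps)
  then have "(M ** C ** N)$1$3 = 1" "(M ** C ** N)$2$3 = 0" "(M ** C ** N)$3$1 = 0" "(M ** C ** N)$3$2 = 1"
    using r0 by (simp_all add: p' rq flip: r_def)
  ultimately have "equiv_tame ((\<lambda>A. M ** A ** N) ` L)"
    by (intro singular_space_normalized singular_space_image L(1))
  then show ?thesis using inv by (rule equiv_tame_image)
qed

text \<open>The corner \<open>(3, 3)\<close> vanishes throughout. If neither the third column nor
  the third row vanishes on all of \<open>L\<close>, some element has both nonzero: one of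
  \<open>A\<close> with nonzero column, \<open>B\<close> with nonzero row, or
  \<open>A + B\<close>.\<close>

lemma singular_space_with_E2:
  assumes L: "singular_space L" "E2 \<in> L"
  shows "equiv_tame L"
proof -
  have sp: "mat_space L" using L by (simp add: singular_space_def)
  note E = singular_space_E2[OF L]
  show ?thesis
  proof (cases "\<forall>A\<in>L. A$1$3 = 0 \<and> A$2$3 = 0")
    case True
    have "A$i$3 = 0" if "A \<in> L" for A i
      using that True E(1) exhaust_3[of i] by metis
    then show ?thesis by (intro tame_equiv_tame) (simp add: tame_def)
  next
    case q: False
    show ?thesis
    proof (cases "\<forall>A\<in>L. A$3$1 = 0 \<and> A$3$2 = 0")
      case True
      have "A$3$i = 0" if "A \<in> L" for A i
        using that True E(1) exhaust_3[of i] by metis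
      then show ?thesis by (intro tame_equiv_tame) (simp add: tame_def)
    next
      case False
      then obtain B where B: "B \<in> L" "B$3$1 \<noteq> 0 \<or> B$3$2 \<noteq> 0" by blast
      obtain A where A: "A \<in> L" "A$1$3 \<noteq> 0 \<or> A$2$3 \<noteq> 0" using q by blast
      define D where "D = (\<chi> i j. A$i$j + 1 * B$i$j)"
      have D: "D \<in> L" unfolding D_def by (rule mat_spaceD[OF sp A(1) B(1)])
      have e: "D$i$j = A$i$j + B$i$j" for i j by (simp add: D_def)
      have *: ?thesis if "C \<in> L" "C$1$3 \<noteq> 0 \<or> C$2$3 \<noteq> 0" "C$3$1 \<noteq> 0 \<or> C$3$2 \<noteq> 0" for C
        by (rule singular_space_change_basis[OF L that])
      consider "A$3$1 \<noteq> 0 \<or> A$3$2 \<noteq> 0" | "B$1$3 \<noteq> 0 \<or> B$2$3 \<noteq> 0"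
        | "A$3$1 = 0" "A$3$2 = 0" "B$1$3 = 0" "B$2$3 = 0" by blast
      then show ?thesis
      proof cases
        case 1
        then show ?thesis by (rule *[OF A])
      next
        case 2
        then show ?thesis using B(2) by (rule *[OF B(1)])
      next
        case 3
        show ?thesis by (rule *[OF D]) (use A(2) B(2) in \<open>simp_all add: e 3\<close>)
      qed
    qed
  qed
qed

text \<open>Equivalence to \<open>E2\<close> stands for rank 2. By Cramer's rule the third column is
  the combination of the first two with coefficients \<open>u\<close>, \<open>v\<close>, the third
  row likewise with \<open>x\<close>, \<open>y\<close>; \<open>det A = 0\<close> gives the corner
  entry. Eliminating both and inverting the upper left block yields \<open>E2\<close>.\<close>

lemma equivalent_E2:
  assumes "det A = 0" "A$1$1 * A$2$2 \<noteq> A$1$2 * A$2$1"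
  shows "equivalent A E2"
proof -
  define d where "d = A$1$1 * A$2$2 - A$1$2 * A$2$1"
  have d: "d \<noteq> 0" using assms(2) by (simp add: d_def)
  define u v where "u = (A$2$2 * A$1$3 - A$1$2 * A$2$3) / d" and "v = (A$1$1 * A$2$3 - A$2$1 * A$1$3) / d"
  define x y where "x = (A$3$1 * A$2$2 - A$3$2 * A$2$1) / d" and "y = (A$3$2 * A$1$1 - A$3$1 * A$1$2) / d"
  let ?M = "mat3 (A$2$2 / d) (- A$1$2 / d) 0 (- A$2$1 / d) (A$1$1 / d) 0 (- x) (- y) 1"
  let ?N = "mat3 1 0 (- u) 0 1 (- v) 0 0 1"
  have "A$2$2 / d * (A$1$1 / d) - A$1$2 / d * (A$2$1 / d) = 1 / d"
    using d by (simp add: field_simps) (simp add: d_def algebra_simps)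
  then have "invertible ?M" "invertible ?N"
    using d by (rule invertible_mat_1 | simp add: invertible_det_nz det_3)+
  moreover have "?M ** A ** ?N = E2"
  proof -
    have u: "u * d = A$2$2 * A$1$3 - A$1$2 * A$2$3" and v: "v * d = A$1$1 * A$2$3 - A$2$1 * A$1$3"
      and x: "x * d = A$3$1 * A$2$2 - A$3$2 * A$2$1" and y: "y * d = A$3$2 * A$1$1 - A$3$1 * A$1$2"
      using d by (simp_all add: u_def v_def x_def y_def)
    have r: "A$1$1 * u + A$1$2 * v = A$1$3" "A$2$1 * u + A$2$2 * v = A$2$3"
      "A$3$1 = x * A$1$1 + y * A$2$1" "A$3$2 = x * A$1$2 + y * A$2$2"
      using u v x y d unfolding d_def by algebra+
    have s: "A$3$1 * u + A$3$2 * v = A$3$3"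
      using assms(1)[unfolded det_3] u v d unfolding d_def by algebra
    have t: "A$2$2 * A$1$1 / d - A$1$2 * A$2$1 / d = 1" "A$1$1 * A$2$2 / d - A$2$1 * A$1$2 / d = 1"
      using d by (simp_all add: d_def mult.commute flip: diff_divide_distrib)
    have "A ** ?N = mat3 (A$1$1) (A$1$2) 0 (A$2$1) (A$2$2) 0 (A$3$1) (A$3$2) 0"
      unfolding vec_eq_iff forall_3 by (simp add: matrix_matrix_mult_def sum_3 flip: r(1,2) s)
    moreover have "?M ** mat3 (A$1$1) (A$1$2) 0 (A$2$1) (A$2$2) 0 (A$3$1) (A$3$2) 0 = E2"
      unfolding vec_eq_iff forall_3 using t by (simp add: matrix_matrix_mult_def sum_3 r(3,4) mult.commute)
    ultimately show ?thesis
      by (simp flip: matrix_mul_assoc)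
  qed
  ultimately show ?thesis unfolding equivalent_def by blast
qed

abbreviation "T23 \<equiv> mat3 1 0 0 0 0 1 0 1 0"

text \<open>Swapping the indices 2 and 3 brings each 2 x 2 minor through the entry
  \<open>(1, 1)\<close> to the upper left corner, where \<open>equivalent_E2\<close> excludes a
  nonzero value.\<close>

lemma rank_one_minors:
  assumes "det A = 0" "\<not> equivalent A E2" "i \<noteq> 1" "j \<noteq> 1"
  shows "A$1$1 * A$i$j = A$1$j * A$i$1"
proof -
  have T: "invertible T23" "invertible (mat 1 :: complex^3^3)"
    by (rule invertible_mat_1 | simp add: invertible_det_nz det_3)+
  have *: "(M ** A ** N)$1$1 * (M ** A ** N)$2$2 = (M ** A ** N)$1$2 * (M ** A ** N)$2$1"
    if "invertible M" "invertible N" for M N :: "complex^3^3"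
  proof -
    have "det (M ** A ** N) = 0" by (simp add: det_mul assms(1))
    moreover have "\<not> equivalent (M ** A ** N) E2"
      using equivalent_trans[OF _ that] assms(2) by blast
    ultimately show ?thesis using equivalent_E2 by blast
  qed
  have "A$1$1 * A$2$2 = A$1$2 * A$2$1" "A$1$1 * A$2$3 = A$1$3 * A$2$1"
    "A$1$1 * A$3$2 = A$1$2 * A$3$1" "A$1$1 * A$3$3 = A$1$3 * A$3$1"
    using *[OF T(2,2)] *[OF T(2,1)] *[OF T(1,2)] *[OF T(1,1)]
    by (simp_all add: matrix_matrix_mult_def sum_3 mat_def)
  moreover have "i = 2 \<or> i = 3" "j = 2 \<or> j = 3"
    using assms(3,4) exhaust_3[of i] exhaust_3[of j] by auto
  ultimately show ?thesis by (elim disjE) simp_all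
qed

lemma invertible_first_row:
  obtains R :: "complex^3^3" where "invertible R" "\<And>A :: complex^3^3. (R ** A) $ 1 = A $ i"
    "\<And>(A :: complex^3^3) a. (A ** transpose R) $ a $ 1 = A $ a $ i"
proof -
  consider "i = 1" | "i = 2" | "i = 3" using exhaust_3[of i] by blast
  then show ?thesis
  proof cases
    case 1
    then show ?thesis
      by (intro that[of "mat3 1 0 0 0 1 0 0 0 1"])
        (simp_all add: invertible_det_nz det_3 matrix_matrix_mult_def transpose_def vec_eq_iff sum_3)
  next
    case 2
    then show ?thesis
      by (intro that[of "mat3 0 1 0 1 0 0 0 0 1"])
        (simp_all add: invertible_det_nz det_3 matrix_matrix_mult_def transpose_def vec_eq_iff sum_3)
  next
    case 3
    then show ?thesis
      by (intro that[of "mat3 0 0 1 0 1 0 1 0 0"])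
        (simp_all add: invertible_det_nz det_3 matrix_matrix_mult_def transpose_def vec_eq_iff sum_3)
  qed
qed

text \<open>The cases are maximal rank 2, 1 and 0. In rank 1 some element becomes \<open>E1\<close>;
  the minors of \<open>C\<close> and \<open>C + E1\<close> through \<open>(1, 1)\<close> and
  \<open>(a, b)\<close> both vanish and differ by \<open>C $ a $ b\<close>, which gives a zero
  block.\<close>

lemma singular_space_equiv_tame:
  assumes L: "singular_space L"
  shows "equiv_tame L"
proof (cases "\<exists>A\<in>L. equivalent A E2")
  case True
  then obtain A where A: "A \<in> L" "equivalent A E2" by blast
  then obtain M N where MN: "invertible M" "invertible N" "M ** A ** N = E2"
    unfolding equivalent_def by blast
  have "M ** A ** N \<in> (\<lambda>A. M ** A ** N) ` L" using A(1) by (rule imageI)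
  then have "equiv_tame ((\<lambda>A. M ** A ** N) ` L)"
    unfolding MN(3) by (intro singular_space_with_E2 singular_space_image L)
  then show ?thesis using MN(1,2) by (rule equiv_tame_image)
next
  case no2: False
  show ?thesis
  proof (cases "\<exists>A\<in>L. \<exists>i j. A$i$j \<noteq> 0")
    case False
    then have "tame L" by (simp add: tame_def)
    then show ?thesis by (rule tame_equiv_tame)
  next
    case True
    then obtain A i j where A: "A \<in> L" "A$i$j \<noteq> 0" by blast
    obtain R :: "complex^3^3" where R: "invertible R" "\<And>A :: complex^3^3. (R ** A) $ 1 = A $ i"
      "\<And>(A :: complex^3^3) a. (A ** transpose R) $ a $ 1 = A $ a $ i"
      by (rule invertible_first_row[of i]) (rule that)
    obtain R' :: "complex^3^3" where R': "invertible R'" "\<And>A :: complex^3^3. (R' ** A) $ 1 = A $ j"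
      "\<And>(A :: complex^3^3) a. (A ** transpose R') $ a $ 1 = A $ a $ j"
      by (rule invertible_first_row[of j]) (rule that)
    define A' where "A' = R ** A ** transpose R'"
    have inv: "invertible (transpose R')" using R'(1) by (simp add: invertible_det_nz)
    have nz: "A'$1$1 \<noteq> 0"
      using A by (simp add: A'_def R'(3) R(2))
    have "det A' = 0"
      using L A by (simp add: A'_def det_mul singular_space_def)
    moreover have "\<not> equivalent A' E2"
      using no2 A(1) equivalent_trans[OF _ R(1) inv] unfolding A'_def by blast
    ultimately have m: "A'$1$1 * A'$a$b = A'$1$b * A'$a$1" if "a \<noteq> 1" "b \<noteq> 1" for a b
      using rank_one_minors that by blast
    define al where "al = A'$1$1"
    let ?M = "mat3 (1 / al) 0 0 (- A'$2$1 / al) 1 0 (- A'$3$1 / al) 0 1"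
    let ?N = "mat3 1 (- A'$1$2 / al) (- A'$1$3 / al) 0 1 0 0 0 1"
    have MN: "invertible ?M" "invertible ?N"
      using nz by (simp_all add: invertible_det_nz det_3 al_def)
    have "al \<noteq> 0" using nz by (simp add: al_def)
    moreover have "A'$2$2 = A'$1$2 * A'$2$1 / al" "A'$2$3 = A'$1$3 * A'$2$1 / al"
      "A'$3$2 = A'$1$2 * A'$3$1 / al" "A'$3$3 = A'$1$3 * A'$3$1 / al"
      using nz m[of 2 2] m[of 2 3] m[of 3 2] m[of 3 3] by (simp_all add: al_def field_simps)
    moreover have "A'$1$1 = al" by (simp add: al_def)
    ultimately have "?M ** A' ** ?N = E1"
      unfolding vec_eq_iff forall_3 by (simp add: matrix_matrix_mult_def sum_3)
    then have E1: "(?M ** R) ** A ** (transpose R' ** ?N) = E1"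
      unfolding A'_def mult_assoc_5 .
    define P Q where "P = ?M ** R" and "Q = transpose R' ** ?N"
    have PQ: "invertible P" "invertible Q"
      using MN R(1) inv by (simp_all add: P_def Q_def invertible_mult)
    let ?L = "(\<lambda>A. P ** A ** Q) ` L"
    have sL: "singular_space ?L" by (rule singular_space_image[OF L])
    have E1: "E1 \<in> ?L" using E1 A(1) unfolding P_def Q_def by (intro image_eqI[of _ _ A]) (simp_all only:)
    have no2': "\<not> equivalent C E2" if "C \<in> ?L" for C
      using that no2 equivalent_trans[OF _ PQ] by blast
    show ?thesis
    proof (rule equiv_tame_block[OF PQ])
      fix A and a b :: 3 assume "A \<in> L" and ab: "a \<noteq> 1" "b \<noteq> 1"
      define C where "C = P ** A ** Q"
      have C: "C \<in> ?L" using \<open>A \<in> L\<close> by (simp add: C_def)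
      have sing: "det B = 0 \<and> \<not> equivalent B E2" if "B \<in> ?L" for B
        using that sL no2' unfolding singular_space_def by blast
      define C' where "C' = (\<chi> i j. C$i$j + 1 * E1$i$j)"
      have C': "C' \<in> ?L"
        unfolding C'_def using sL C E1 unfolding singular_space_def by (intro mat_spaceD) blast+
      have e: "C'$1$1 = C$1$1 + 1" "C'$1$b = C$1$b" "C'$a$1 = C$a$1" "C'$a$b = C$a$b"
        using ab exhaust_3[of a] exhaust_3[of b] unfolding C'_def by auto
      have "(C$1$1 + 1) * C$a$b = C$1$b * C$a$1"
        using rank_one_minors[of C' a b] sing[OF C'] ab unfolding e by blast
      moreover have "C$1$1 * C$a$b = C$1$b * C$a$1"
        using rank_one_minors[of C a b] sing[OF C] ab by blast
      ultimately show "(P ** A ** Q)$a$b = 0"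
        unfolding C_def[symmetric] by algebra
    qed
  qed
qed

subsection \<open>The null cone\<close>

text \<open>The limit \<open>t \<rightarrow> 0\<close> of a one-parameter subgroup that acts with positive weights.\<close>

lemma positive_weights_zero:
  fixes X :: "complex^3^3^'m::finite"
  assumes f: "f \<in> invariants" "homogeneous d f" "d > 0"
    and w: "\<And>l i j. w i j = 0 \<Longrightarrow> X $ l $ i $ j = 0"
    and act: "\<And>t. t \<noteq> 0 \<Longrightarrow> det (A t) = 1 \<and> det (B t) = 1 \<and>
      (\<forall>l. A t ** X $ l ** B t = (\<chi> i j. t ^ w i j * X $ l $ i $ j))"
  shows "eval_poly f X = 0"
proof -
  define W where "W t = (\<chi> l i j. t ^ w i j * X $ l $ i $ j)" for t
  have "eval_poly f (W t) - eval_poly f X = 0" if "poly [:0, 1:] t \<noteq> 0" for t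
  proof -
    have t: "t \<noteq> 0" using that by simp
    have "W t = (\<chi> l. A t ** X $ l ** B t)"
      using act[OF t] by (simp add: W_def vec_eq_iff)
    then show ?thesis
      using eval_act[OF f(1), of "A t" "B t" X] act[OF t] by simp
  qed
  moreover have "continuous_on UNIV (\<lambda>t. eval_poly f (W t) - eval_poly f X)"
    unfolding W_def
    by (intro continuous_intros continuous_on_eval_poly continuous_on_vec_lambda)
  ultimately have "eval_poly f (W 0) - eval_poly f X = 0"
    by (intro poly_mult_zero_imp_zero[of "\<lambda>t. eval_poly f (W t) - eval_poly f X" "[:0, 1:]" 0]) simp_all
  \<comment> \<open>As \<open>0 ^ 0 = 1\<close>, entries of weight 0 survive at
    \<open>t = 0\<close>; these are the entries where \<open>X\<close> is zero.\<close>
  moreover have "W 0 = 0"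
    unfolding W_def vec_eq_iff using w by (simp add: power_0_left)
  ultimately show ?thesis
    using eval_poly_at_0[OF f(2,3)] by simp
qed

text \<open>The columns are scaled with exponents 1, 1, -2; the negative one meets only the zero
  column, so the constant weight 1 describes the action.\<close>

lemma eval_poly_zero_column:
  fixes X :: "complex^3^3^'m::finite"
  assumes f: "f \<in> invariants" "homogeneous d f" "d > 0" and X: "\<And>l i. X $ l $ i $ 3 = 0"
  shows "eval_poly f X = 0"
proof (rule positive_weights_zero[OF f, where w = "\<lambda>i j. 1" and A = "\<lambda>t. mat 1"
    and B = "\<lambda>t. mat3 t 0 0 0 t 0 0 0 (1 / t^2)"])
  fix t :: complex assume t: "t \<noteq> 0"
  have "mat 1 ** X $ l ** mat3 t 0 0 0 t 0 0 0 (1 / t^2) = (\<chi> i j. t ^ 1 * X $ l $ i $ j)" for l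
    unfolding matrix_mul_lid vec_eq_iff forall_3 by (simp add: matrix_matrix_mult_def sum_3 X)
  moreover have "det (mat3 t 0 0 0 t 0 0 0 (1 / t^2)) = 1"
    using t by (simp add: det_3 power2_eq_square)
  ultimately show "det (mat 1 :: complex^3^3) = 1 \<and> det (mat3 t 0 0 0 t 0 0 0 (1 / t^2)) = 1 \<and>
      (\<forall>l. mat 1 ** X $ l ** mat3 t 0 0 0 t 0 0 0 (1 / t^2) = (\<chi> i j. t ^ 1 * X $ l $ i $ j))"
    by simp
qed simp

lemma eval_poly_zero_row:
  fixes X :: "complex^3^3^'m::finite"
  assumes f: "f \<in> invariants" "homogeneous d f" "d > 0" and X: "\<And>l i. X $ l $ 3 $ i = 0"
  shows "eval_poly f X = 0"
proof (rule positive_weights_zero[OF f, where w = "\<lambda>i j. 1" and B = "\<lambda>t. mat 1"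
    and A = "\<lambda>t. mat3 t 0 0 0 t 0 0 0 (1 / t^2)"])
  fix t :: complex assume t: "t \<noteq> 0"
  have "mat3 t 0 0 0 t 0 0 0 (1 / t^2) ** X $ l ** mat 1 = (\<chi> i j. t ^ 1 * X $ l $ i $ j)" for l
    unfolding matrix_mul_rid vec_eq_iff forall_3 by (simp add: matrix_matrix_mult_def sum_3 X)
  moreover have "det (mat3 t 0 0 0 t 0 0 0 (1 / t^2)) = 1"
    using t by (simp add: det_3 power2_eq_square)
  ultimately show "det (mat3 t 0 0 0 t 0 0 0 (1 / t^2)) = 1 \<and> det (mat 1 :: complex^3^3) = 1 \<and>
      (\<forall>l. mat3 t 0 0 0 t 0 0 0 (1 / t^2) ** X $ l ** mat 1 = (\<chi> i j. t ^ 1 * X $ l $ i $ j))"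
    by simp
qed simp

lemma eval_poly_zero_block:
  fixes X :: "complex^3^3^'m::finite"
  assumes f: "f \<in> invariants" "homogeneous d f" "d > 0"
    and X: "\<And>l i j. i \<noteq> 1 \<Longrightarrow> j \<noteq> 1 \<Longrightarrow> X $ l $ i $ j = 0"
  shows "eval_poly f X = 0"
proof -
  define D where "D t = mat3 (t^2) 0 0 0 (1 / t) 0 0 0 (1 / t)" for t
  \<comment> \<open>The exponents of \<open>D t\<close> on both sides add up to
    \<open>2 + 2\<close>, \<open>2 - 1\<close> or \<open>-1 - 1\<close>; the last kind falls on zero
    entries and is recorded as 0.\<close>
  define w :: "3 \<Rightarrow> 3 \<Rightarrow> nat" where "w i j = (if i = 1 \<and> j = 1 then 4 else if i = 1 \<or> j = 1 then 1 else 0)" for i j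
  show ?thesis
  proof (rule positive_weights_zero[OF f, of w X D D])
    show "X $ l $ i $ j = 0" if "w i j = 0" for l i j
      using that X[of i j l] by (simp add: w_def split: if_splits)
  next
    fix t :: complex assume t: "t \<noteq> 0"
    have z: "X $ l $ 2 $ 2 = 0" "X $ l $ 2 $ 3 = 0" "X $ l $ 3 $ 2 = 0" "X $ l $ 3 $ 3 = 0" for l
      by (simp_all add: X)
    have "D t ** X $ l ** D t = (\<chi> i j. t ^ w i j * X $ l $ i $ j)" for l
      unfolding vec_eq_iff forall_3 using t
      by (simp add: D_def w_def matrix_matrix_mult_def sum_3 z)
        (simp add: field_simps power2_eq_square eval_nat_numeral)
    moreover have "det (D t) = 1"
      using t by (simp add: D_def det_3 power2_eq_square)
    ultimately show "det (D t) = 1 \<and> det (D t) = 1 \<and> (\<forall>l. D t ** X $ l ** D t = (\<chi> i j. t ^ w i j * X $ l $ i $ j))"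
      by simp
  qed
qed

section \<open>Triple products and skew-symmetric matrices\<close>

definition det3 :: "complex^3 \<Rightarrow> complex^3 \<Rightarrow> complex^3 \<Rightarrow> complex" where
  "det3 a b c = a$1 * (b$2 * c$3 - b$3 * c$2) + a$2 * (b$3 * c$1 - b$1 * c$3) + a$3 * (b$1 * c$2 - b$2 * c$1)"

text \<open>Applied to \<open>u\<close> this is the cross product \<open>u x y\<close>, in that
  order.\<close>

definition skew_mat :: "complex^3 \<Rightarrow> complex^3^3" where
  "skew_mat y = mat3 0 (y$3) (- y$2) (- y$3) 0 (y$1) (y$2) (- y$1) 0"

lemma skewE:
  assumes "skew S"
  obtains y where "S = skew_mat y"
proof
  have s: "S$i$j = - S$j$i" for i j
    using assms unfolding skew_def by blast
  have "S$1$1 = 0" "S$2$2 = 0" "S$3$3 = 0"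
    using s[of 1 1] s[of 2 2] s[of 3 3] by simp_all
  moreover have "S$2$1 = - S$1$2" "S$3$2 = - S$2$3" "S$1$3 = - S$3$1"
    by (rule s)+
  ultimately show "S = skew_mat (vector [S$2$3, S$3$1, S$1$2])"
    by (simp add: skew_mat_def vec_eq_iff forall_3)
qed

text \<open>With triple products \<open>[a b c]\<close>, Cramer's rule reads
  \<open>[a b c] v = [v b c] a - [v a c] b + [v a b] c\<close>; the hypotheses remove the last two
  terms.\<close>

lemma cramer_orthogonal:
  fixes a b c v :: "complex^3"
  assumes "v$1 * (a$2*b$3 - a$3*b$2) + v$2 * (a$3*b$1 - a$1*b$3) + v$3 * (a$1*b$2 - a$2*b$1) = 0"
    "v$1 * (a$2*c$3 - a$3*c$2) + v$2 * (a$3*c$1 - a$1*c$3) + v$3 * (a$1*c$2 - a$2*c$1) = 0"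
  obtains \<beta> where "\<forall>i. det3 a b c * v$i = \<beta> * a$i"
proof
  let ?b = "v$1 * (b$2*c$3 - b$3*c$2) + v$2 * (b$3*c$1 - b$1*c$3) + v$3 * (b$1*c$2 - b$2*c$1)"
  let ?x = "v$1 * (a$2*b$3 - a$3*b$2) + v$2 * (a$3*b$1 - a$1*b$3) + v$3 * (a$1*b$2 - a$2*b$1)"
  let ?y = "v$1 * (a$2*c$3 - a$3*c$2) + v$2 * (a$3*c$1 - a$1*c$3) + v$3 * (a$1*c$2 - a$2*c$1)"
  have "det3 a b c * v$1 = ?b * a$1 - ?y * b$1 + ?x * c$1" "det3 a b c * v$2 = ?b * a$2 - ?y * b$2 + ?x * c$2"
    "det3 a b c * v$3 = ?b * a$3 - ?y * b$3 + ?x * c$3"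
    by (simp_all add: det3_def algebra_simps)
  then show "\<forall>i. det3 a b c * v$i = ?b * a$i"
    unfolding assms forall_3 by simp
qed

text \<open>A kernel vector \<open>(u, v)\<close> satisfies \<open>u x b + v x a = 0\<close> and
  \<open>u x a + v x c = 0\<close>. Pairing these with \<open>b\<close> and \<open>a\<close> makes
  \<open>v\<close> parallel to \<open>a\<close>; pairing them with \<open>a\<close> and
  \<open>c\<close> does the same for \<open>u\<close>. What remains are multiples of
  \<open>a x b\<close> and \<open>a x c\<close>, and pairing with \<open>c\<close> and
  \<open>b\<close> forces the factors to be 0.\<close>

lemma det_block_skew_nonzero:
  assumes "det3 a b c \<noteq> 0"
  shows "det (block_mat (skew_mat b) (skew_mat a) (skew_mat a) (skew_mat c)) \<noteq> 0"
proof
  let ?B = "block_mat (skew_mat b) (skew_mat a) (skew_mat a) (skew_mat c)"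
  assume "det ?B = 0"
  then obtain w where w: "w \<noteq> 0" "?B *v w = 0" by (rule singular_kernel)
  define u v :: "complex^3" where "u = (\<chi> i. w $ Inl i)" and "v = (\<chi> i. w $ Inr i)"
  define T where "T = det3 a b c"
  have "(?B *v w) $ r = 0" for r using w(2) by simp
  from this[of "Inl 1"] this[of "Inl 2"] this[of "Inl 3"] this[of "Inr 1"] this[of "Inr 2"] this[of "Inr 3"]
  have e: "b$3 * u$2 - b$2 * u$3 + (a$3 * v$2 - a$2 * v$3) = 0"
    "b$1 * u$3 - b$3 * u$1 + (a$1 * v$3 - a$3 * v$1) = 0"
    "b$2 * u$1 - b$1 * u$2 + (a$2 * v$1 - a$1 * v$2) = 0"
    "a$3 * u$2 - a$2 * u$3 + (c$3 * v$2 - c$2 * v$3) = 0"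
    "a$1 * u$3 - a$3 * u$1 + (c$1 * v$3 - c$3 * v$1) = 0"
    "a$2 * u$1 - a$1 * u$2 + (c$2 * v$1 - c$1 * v$2) = 0"
    by (simp_all add: matrix_vector_mult_def sum_UNIV_Plus sum_3 skew_mat_def u_def v_def algebra_simps)
  let ?e1 = "b$3 * u$2 - b$2 * u$3 + (a$3 * v$2 - a$2 * v$3)"
  let ?e2 = "b$1 * u$3 - b$3 * u$1 + (a$1 * v$3 - a$3 * v$1)"
  let ?e3 = "b$2 * u$1 - b$1 * u$2 + (a$2 * v$1 - a$1 * v$2)"
  let ?e4 = "a$3 * u$2 - a$2 * u$3 + (c$3 * v$2 - c$2 * v$3)"
  let ?e5 = "a$1 * u$3 - a$3 * u$1 + (c$1 * v$3 - c$3 * v$1)"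
  let ?e6 = "a$2 * u$1 - a$1 * u$2 + (c$2 * v$1 - c$1 * v$2)"
  have "v$1 * (a$2*b$3 - a$3*b$2) + v$2 * (a$3*b$1 - a$1*b$3) + v$3 * (a$1*b$2 - a$2*b$1)
      = b$1 * ?e1 + b$2 * ?e2 + b$3 * ?e3"
    "v$1 * (a$2*c$3 - a$3*c$2) + v$2 * (a$3*c$1 - a$1*c$3) + v$3 * (a$1*c$2 - a$2*c$1)
      = - (a$1 * ?e4 + a$2 * ?e5 + a$3 * ?e6)"
    by (simp_all add: algebra_simps)
  then obtain \<beta> where \<beta>: "\<forall>i. T * v$i = \<beta> * a$i"
    unfolding T_def using cramer_orthogonal[of v a b c] unfolding e by auto
  have "u$1 * (a$2*b$3 - a$3*b$2) + u$2 * (a$3*b$1 - a$1*b$3) + u$3 * (a$1*b$2 - a$2*b$1)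
      = - (a$1 * ?e1 + a$2 * ?e2 + a$3 * ?e3)"
    "u$1 * (a$2*c$3 - a$3*c$2) + u$2 * (a$3*c$1 - a$1*c$3) + u$3 * (a$1*c$2 - a$2*c$1)
      = c$1 * ?e4 + c$2 * ?e5 + c$3 * ?e6"
    by (simp_all add: algebra_simps)
  then obtain \<alpha> where \<alpha>: "\<forall>i. T * u$i = \<alpha> * a$i"
    unfolding T_def using cramer_orthogonal[of u a b c] unfolding e by auto
  have "T * (c$1 * ?e1 + c$2 * ?e2 + c$3 * ?e3)
    = c$1 * (b$3 * (T * u$2) - b$2 * (T * u$3) + (a$3 * (T * v$2) - a$2 * (T * v$3)))
    + c$2 * (b$1 * (T * u$3) - b$3 * (T * u$1) + (a$1 * (T * v$3) - a$3 * (T * v$1)))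
    + c$3 * (b$2 * (T * u$1) - b$1 * (T * u$2) + (a$2 * (T * v$1) - a$1 * (T * v$2)))"
    by (simp add: algebra_simps)
  also have "\<dots> = \<alpha> * T"
    unfolding \<alpha>[rule_format] \<beta>[rule_format] by (simp add: T_def det3_def algebra_simps)
  finally have "\<alpha> * T = 0" unfolding e by simp
  moreover have "T * (b$1 * ?e4 + b$2 * ?e5 + b$3 * ?e6)
    = b$1 * (a$3 * (T * u$2) - a$2 * (T * u$3) + (c$3 * (T * v$2) - c$2 * (T * v$3)))
    + b$2 * (a$1 * (T * u$3) - a$3 * (T * u$1) + (c$1 * (T * v$3) - c$3 * (T * v$1)))
    + b$3 * (a$2 * (T * u$1) - a$1 * (T * u$2) + (c$2 * (T * v$1) - c$1 * (T * v$2)))"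
    by (simp add: algebra_simps)
  then have "T * (b$1 * ?e4 + b$2 * ?e5 + b$3 * ?e6) = - (\<beta> * T)"
    unfolding \<alpha>[rule_format] \<beta>[rule_format] by (simp add: T_def det3_def algebra_simps)
  then have "\<beta> * T = 0" unfolding e by simp
  moreover have T: "T \<noteq> 0" using assms by (simp add: T_def)
  ultimately have "\<alpha> = 0" "\<beta> = 0" by simp_all
  then have "u$i = 0" "v$i = 0" for i
    using \<alpha>[rule_format, of i] \<beta>[rule_format, of i] T by simp_all
  then have "w = 0"
    by (simp add: vec_sum_eq_iff u_def v_def)
  then show False using w(1) by simp
qed

lemma det3_alternating:
  "det3 b a c = - det3 a b c" "det3 a c b = - det3 a b c" "det3 a a c = 0" "det3 a c c = 0" "det3 a c a = 0"
  by (simp_all add: det3_def algebra_simps)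

text \<open>On skew-symmetric tuples the vanishing of \<open>g\<close> forces that of a triple
  product, which alternates; so the \<open>g\<close> with increasing indices control all
  triples.\<close>

lemma det3_zero_all:
  fixes y :: "'m::linorder \<Rightarrow> complex^3"
  assumes "\<And>i j k. i < j \<Longrightarrow> j < k \<Longrightarrow> det3 (y i) (y j) (y k) = 0"
  shows "det3 (y i) (y j) (y k) = 0"
proof -
  have 12: "det3 (y i) (y j) (y k) = 0 \<longleftrightarrow> det3 (y j) (y i) (y k) = 0" for i j k
    by (subst det3_alternating(1)) simp
  have 23: "det3 (y i) (y j) (y k) = 0 \<longleftrightarrow> det3 (y i) (y k) (y j) = 0" for i j k
    by (subst det3_alternating(2)) simp
  consider "i = j" | "j = k" | "i = k" | "i < j" "j < k" | "i < k" "k < j" | "j < i" "i < k"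
    | "j < k" "k < i" | "k < i" "i < j" | "k < j" "j < i"
    using linorder_less_linear[of i j] linorder_less_linear[of j k] linorder_less_linear[of i k] by blast
  then show ?thesis
  proof cases
    case 4
    then show ?thesis by (rule assms)
  next
    case 5
    from assms[OF this] show ?thesis by (subst 23)
  next
    case 6
    from assms[OF this] show ?thesis by (subst 12)
  next
    case 7
    from assms[OF this] show ?thesis by (subst 12, subst 23)
  next
    case 8
    from assms[OF this] show ?thesis by (subst 23, subst 12)
  next
    case 9
    from assms[OF this] show ?thesis by (subst 12, subst 23, subst 12)
  qed (simp_all add: det3_alternating(3-5))
qed

text \<open>All \<open>y l\<close> lie in one plane, and \<open>n\<close> is a normal vector: a
  nonzero cross product of two of them or, if all are parallel, a vector orthogonal to a nonzero
  \<open>y i\<close>.\<close>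

lemma common_orthogonal_vector:
  assumes D: "\<And>i j k. det3 (y i) (y j) (y k) = 0"
  obtains n :: "complex^3" where "n \<noteq> 0" "\<And>l. n$1 * y l$1 + n$2 * y l$2 + n$3 * y l$3 = 0"
proof -
  define cr :: "complex^3 \<Rightarrow> complex^3 \<Rightarrow> complex^3" where
    "cr a b = vector [a$2*b$3 - a$3*b$2, a$3*b$1 - a$1*b$3, a$1*b$2 - a$2*b$1]" for a b
  show ?thesis
  proof (cases "\<exists>i j. cr (y i) (y j) \<noteq> 0")
    case True
    then obtain i j where "cr (y i) (y j) \<noteq> 0" by blast
    moreover have "cr (y i) (y j)$1 * y l$1 + cr (y i) (y j)$2 * y l$2 + cr (y i) (y j)$3 * y l$3 = det3 (y l) (y i) (y j)" for l
      by (simp add: cr_def det3_def algebra_simps)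
    ultimately show ?thesis using that D by simp
  next
    case False
    then have c: "y i$2 * y j$3 = y i$3 * y j$2" "y i$3 * y j$1 = y i$1 * y j$3" "y i$1 * y j$2 = y i$2 * y j$1" for i j
      by (simp_all add: cr_def vec_eq_iff forall_3)
    show ?thesis
    proof (cases "\<exists>i. y i \<noteq> 0")
      case False
      then show ?thesis using that[of "vector [1, 0, 0]"] by (simp add: vec_eq_iff forall_3)
    next
      case True
      then obtain i where "y i \<noteq> 0" by blast
      then consider "y i$1 \<noteq> 0" | "y i$2 \<noteq> 0" | "y i$3 \<noteq> 0"
        by (auto simp: vec_eq_iff forall_3)
      then show ?thesis
      proof cases
        case 1
        then show ?thesis
          using c(3)[of i] by (intro that[of "vector [- y i$2, y i$1, 0]"]) (auto simp: vec_eq_iff forall_3)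
      next
        case 2
        then show ?thesis
          using c(3)[of i] by (intro that[of "vector [- y i$2, y i$1, 0]"]) (auto simp: vec_eq_iff forall_3)
      next
        case 3
        then show ?thesis
          using c(2)[of i] by (intro that[of "vector [y i$3, 0, - y i$1]"]) (auto simp: vec_eq_iff forall_3)
      qed
    qed
  qed
qed

text \<open>A skew-symmetric form \<open>S\<close> with kernel vector \<open>y\<close> vanishes on every plane through \<open>y\<close>; here
  the plane is the orthogonal complement of \<open>n\<close>, spanned by the last two columns of \<open>Q\<close>.\<close>

lemma skew_plane:
  fixes n :: "complex^3"
  assumes "n \<noteq> 0"
  obtains Q :: "complex^3^3" where "invertible Q"
    "\<And>y i j. n$1 * y$1 + n$2 * y$2 + n$3 * y$3 = 0 \<Longrightarrow> i \<noteq> 1 \<Longrightarrow> j \<noteq> 1 \<Longrightarrow>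
       (transpose Q ** skew_mat y ** Q) $ i $ j = 0"
proof -
  note basis = that
  have red: thesis if Q: "det Q \<noteq> 0"
    and r: "\<And>y. n$1 * y$1 + n$2 * y$2 + n$3 * y$3 = 0 \<Longrightarrow>
      (transpose Q ** skew_mat y ** Q) $ 2 $ 2 = 0 \<and> (transpose Q ** skew_mat y ** Q) $ 2 $ 3 = 0 \<and>
      (transpose Q ** skew_mat y ** Q) $ 3 $ 2 = 0 \<and> (transpose Q ** skew_mat y ** Q) $ 3 $ 3 = 0" for Q :: "complex^3^3"
  proof (rule basis[of Q])
    show "invertible Q" using Q by (simp add: invertible_det_nz)
    fix y :: "complex^3" and i j :: 3 assume y: "n$1 * y$1 + n$2 * y$2 + n$3 * y$3 = 0" and ij: "i \<noteq> 1" "j \<noteq> 1"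
    have "i = 2 \<or> i = 3" "j = 2 \<or> j = 3"
      using ij exhaust_3[of i] exhaust_3[of j] by auto
    then show "(transpose Q ** skew_mat y ** Q) $ i $ j = 0"
      using r[OF y] by (elim disjE) simp_all
  qed
  consider "n$1 \<noteq> 0" | "n$2 \<noteq> 0" | "n$3 \<noteq> 0"
    using assms by (auto simp: vec_eq_iff forall_3)
  then show ?thesis
  proof cases
    case 1
    show ?thesis
    proof (rule red[where Q = "mat3 1 (n$2) (n$3) 0 (- n$1) 0 0 0 (- n$1)"], goal_cases)
      case (2 y)
      then have e: "n$1 * y$1 = - (n$2 * y$2) - n$3 * y$3"
        by algebra
      show ?case
        by (simp add: e skew_mat_def transpose_def matrix_matrix_mult_def sum_3 algebra_simps)
    qed (use 1 in \<open>simp add: det_3\<close>)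
  next
    case 2
    show ?thesis
    proof (rule red[where Q = "mat3 0 (- n$2) 0 1 (n$1) (n$3) 0 0 (- n$2)"], goal_cases)
      case (2 y)
      then have e: "n$2 * y$2 = - (n$1 * y$1) - n$3 * y$3"
        by algebra
      show ?case
        by (simp add: e skew_mat_def transpose_def matrix_matrix_mult_def sum_3 algebra_simps)
    qed (use 2 in \<open>simp add: det_3\<close>)
  next
    case 3
    show ?thesis
    proof (rule red[where Q = "mat3 0 (- n$3) 0 0 0 (- n$3) 1 (n$1) (n$2)"], goal_cases)
      case (2 y)
      then have e: "n$3 * y$3 = - (n$1 * y$1) - n$2 * y$2"
        by algebra
      show ?case
        by (simp add: e skew_mat_def transpose_def matrix_matrix_mult_def sum_3 algebra_simps)
    qed (use 3 in \<open>simp add: det_3\<close>)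
  qed
qed

lemma singular_space_lincomb:
  fixes X :: "complex^3^3^'m::finite"
  assumes "\<And>t. det (lincomb t X) = 0"
  shows "singular_space (range (\<lambda>t. lincomb t X))"
proof -
  have "(\<chi> i j. lincomb s X $ i $ j + c * lincomb t X $ i $ j) = lincomb (\<lambda>l. s l + c * t l) X" for s t c
    by (simp add: lincomb_def vec_eq_iff sum.distrib sum_distrib_left ring_distribs mult.assoc)
  then have "(\<chi> i j. lincomb s X $ i $ j + c * lincomb t X $ i $ j) \<in> range (\<lambda>t. lincomb t X)" for s t c
    by (simp add: rangeI)
  then show ?thesis
    using assms unfolding singular_space_def mat_space_def by blast
qed

lemma nth_lincomb: "X $ l = lincomb (\<lambda>k. if k = l then 1 else 0) X"
  by (simp add: lincomb_def vec_eq_iff if_distrib if_distribR sum.delta cong: if_cong)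

lemma invariant_vanishes:
  fixes X :: "complex^3^3^'m::{finite,linorder}"
  assumes D: "\<And>t. det (lincomb t X) = 0"
    and g: "\<And>i j k. i < j \<Longrightarrow> j < k \<Longrightarrow> eval_poly (g_poly i j k) X = 0"
    and f: "f \<in> invariants" "homogeneous d f" "d > 0"
  shows "eval_poly f X = 0"
proof -
  have "equiv_tame (range (\<lambda>t. lincomb t X))"
    by (intro singular_space_equiv_tame singular_space_lincomb D)
  then obtain M N :: "complex^3^3" where MN: "invertible M" "invertible N"
    and tame: "tame ((\<lambda>A. M ** A ** N) ` range (\<lambda>t. lincomb t X))"
    unfolding equiv_tame_def by blast
  define Y where "Y = (\<chi> l. M ** X $ l ** N)"
  have Y: "Y $ l \<in> (\<lambda>A. M ** A ** N) ` range (\<lambda>t. lincomb t X)" for l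
    unfolding Y_def vec_lambda_beta by (rule imageI) (subst nth_lincomb, rule rangeI)
  have GL: "eval_poly f' Y = 0 \<longleftrightarrow> eval_poly f' X = 0" if "f' \<in> invariants" "homogeneous d' f'" for f' d'
    unfolding Y_def by (rule eval_GL[OF that MN])
  from tame consider "\<And>l i. Y $ l $ i $ 3 = 0" | "\<And>l j. Y $ l $ 3 $ j = 0"
    | "\<And>l i j. i \<noteq> 1 \<Longrightarrow> j \<noteq> 1 \<Longrightarrow> Y $ l $ i $ j = 0" | "\<And>l. skew (Y $ l)"
    unfolding tame_def using Y by (elim disjE) simp_all
  then have "eval_poly f Y = 0"
  proof cases
    case 1
    then show ?thesis by (rule eval_poly_zero_column[OF f])
  next
    case 2
    then show ?thesis by (rule eval_poly_zero_row[OF f])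
  next
    case 3
    then show ?thesis by (rule eval_poly_zero_block[OF f])
  next
    case 4
    then have "\<forall>l. \<exists>y. Y $ l = skew_mat y" by (metis skewE)
    from choice[OF this] obtain y where y: "\<And>l. Y $ l = skew_mat (y l)" by blast
    have "det3 (y i) (y j) (y k) = 0" if "i < j" "j < k" for i j k
    proof -
      have "eval_poly (g_poly i j k) Y = 0"
        using g[OF that] g_poly_invariant[where 'n = 3, of i j k] GL[of "g_poly i j k" 6] by (simp add: invariants_of_degree_def)
      then show ?thesis
        using det_block_skew_nonzero[of "y i" "y j" "y k"] by (auto simp: eval_g_poly y)
    qed
    then have D: "det3 (y i) (y j) (y k) = 0" for i j k
      by (rule det3_zero_all)
    obtain n :: "complex^3" where n: "n \<noteq> 0" "\<And>l. n$1 * y l$1 + n$2 * y l$2 + n$3 * y l$3 = 0"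
      by (rule common_orthogonal_vector[of y, OF D]) (rule that)
    obtain Q :: "complex^3^3" where Q: "invertible Q"
      "\<And>y i j. n$1 * y$1 + n$2 * y$2 + n$3 * y$3 = 0 \<Longrightarrow> i \<noteq> 1 \<Longrightarrow> j \<noteq> 1 \<Longrightarrow>
         (transpose Q ** skew_mat y ** Q) $ i $ j = 0"
      by (rule skew_plane[OF n(1)]) (rule that)
    have "eval_poly f (\<chi> l. transpose Q ** Y $ l ** Q) = 0"
    proof (rule eval_poly_zero_block[OF f])
      fix l and i j :: 3 assume "i \<noteq> 1" "j \<noteq> 1"
      then show "(\<chi> l. transpose Q ** Y $ l ** Q) $ l $ i $ j = 0"
        unfolding vec_lambda_beta y by (rule Q(2)[OF n(2)])
    qed
    moreover have "invertible (transpose Q)"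
      using Q(1) by (simp add: invertible_det_nz)
    ultimately show ?thesis
      using eval_GL[OF f(1,2) _ Q(1)] by blast
  qed
  then show ?thesis using GL[OF f(1,2)] by simp
qed

text \<open>The bound is claimed from three matrices on, as many as the slice uses. For two matrices
  \<open>det (s X_1 + t X_2)\<close> has four independent coefficients, more than
  \<open>9 * 2 - 16\<close>; for one, truncated subtraction would give 0 although \<open>det\<close>
  is an invariant.\<close>

theorem proposition1p10:
  shows "(\<forall>(i::'m::{finite,linorder}) j k. i < j \<longrightarrow> j < k \<longrightarrow>
             (g_poly i j k :: (3, 'm) matpoly) \<in> invariants_of_degree 6) \<and>
         (\<exists>F :: (3, 'm) matpoly set.
             finite F \<and> F \<subseteq> invariants_of_degree 3 \<and>
             (3 \<le> CARD('m) \<longrightarrow> card F \<le> 9 * CARD('m) - 16) \<and>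
             zero_set F = zero_set (invariants_of_degree 3) \<and>
             null_cone = zero_set (F \<union> {g_poly i j k | i j k. i < j \<and> j < k}))"
proof -
  have g: "(g_poly i j k :: (3, 'm) matpoly) \<in> invariants_of_degree 6" for i j k
    using g_poly_invariant[where 'n = 3, of i j k] by simp
  obtain F0 :: "(3, 'm) matpoly set" where F0: "finite F0" "F0 \<subseteq> invariants_of_degree 3"
    "zero_set F0 = zero_set (invariants_of_degree 3)"
    by (rule finite_defining_subset[of "invariants_of_degree 3" 3]) (auto simp: invariants_of_degree_def)
  obtain F :: "(3, 'm) matpoly set" where F: "finite F" "F \<subseteq> invariants_of_degree 3"
    "3 \<le> CARD('m) \<longrightarrow> card F \<le> 9 * CARD('m) - 16"
    "zero_set F = zero_set (invariants_of_degree 3)"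
  proof (cases "3 \<le> CARD('m)")
    case True
    then show ?thesis
      using defining_set_reduction[OF F0(1,2) True] that F0(3) by metis
  next
    case False
    then show ?thesis using that[of F0] F0 by simp
  qed
  have "null_cone = zero_set (F \<union> {g_poly i j k | i j k. i < j \<and> j < k})"
  proof (intro equalityI subsetI)
    fix X :: "(complex^3^3, 'm) vec" assume "X \<in> null_cone"
    then have X: "eval_poly f X = 0" if "f \<in> invariants_of_degree d" "d > 0" for f d
      using that unfolding null_cone_def zero_set_def by blast
    have "eval_poly f X = 0" if "f \<in> F" for f
      using X[of f 3] that F(2) by auto
    moreover have "eval_poly (g_poly i j k) X = 0" for i j k
      using X[OF g] by simp
    ultimately show "X \<in> zero_set (F \<union> {g_poly i j k | i j k. i < j \<and> j < k})"
      unfolding zero_set_def by auto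
  next
    fix X :: "(complex^3^3, 'm) vec"
    assume "X \<in> zero_set (F \<union> {g_poly i j k | i j k. i < j \<and> j < k})"
    then have X: "X \<in> zero_set F" and gX: "\<And>i j k. i < j \<Longrightarrow> j < k \<Longrightarrow> eval_poly (g_poly i j k) X = 0"
      unfolding zero_set_def by auto
    have "eval_poly (pencil_poly t) X = 0" for t
      using X[unfolded F(4)] pencil_poly_invariant[where 'n = 3, of t] unfolding zero_set_def by auto
    then have "det (lincomb t X) = 0" for t
      by (simp add: eval_pencil_poly)
    then have "eval_poly f X = 0" if "f \<in> invariants_of_degree d" "d > 0" for f d
      using that gX by (intro invariant_vanishes[of X f d]) (auto simp: invariants_of_degree_def)
    then show "X \<in> null_cone"
      unfolding null_cone_def zero_set_def by auto
  qed
  then show ?thesis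
    using g F by blast
qed

end
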